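(* Let $H=L^2(\Omega)$, let $\beta_1,\beta_2\in L_{1,\mathrm{loc}}(0,\infty)$ and $\mathbf B_1,\mathbf B_2$ be kernels and operators satisfying the standing assumptions listed in the context, and let $u$ be the solution of $$\frac{\partial u}{\partial t}+\sum_{q=1}^{2}\int_0^t\beta_q(t-s)\,\mathbf B_q u(s)\,ds=f(t),\quad t>0,\qquad u(0)=u_0 .$$ If $s_0>0$, then $$\|u\|^2_{L^2(H^{0,s_0})}\le s_0^{-1}\|u_0\|^2+s_0^{-2}\|f\|^2_{L^2(H^{0,s_0})}.$$
   Context: $(\cdot,\cdot)$ and $\|\cdot\|$ are the inner product and norm of $L^2(\Omega)$ (real-valued functions). For $w:[0,\infty)\to L^2(\Omega)$ and $s_0>0$, $\|w\|_{L^2(H^{0,s_0})}=\left(\int_0^\infty\|w(t)\|^2e^{-2s_0t}\,dt\right)^{1/2}$. Standing assumptions. Each $\mathbf B_q$ ($q=1,2$) is a positive self-adjoint linear operator defined on a dense subspace $\mathcal D(\mathbf B_q)$ of $H$. Each $\beta_q$ is real-valued and positive definite (of positive type) on $(0,\infty)$, with $\int_0^1\beta_q(t)\,dt<\infty$ and $0\le\beta_q(\infty)<\beta_q(0^+)\le\infty$. A kernel $\beta\in L_{1,\mathrm{loc}}(0,\infty)$ is of positive type if $\int_0^T\varphi(t)\int_0^t\beta(t-s)\varphi(s)\,ds\,dt\ge0$ for all $T>0$ and all continuous real $\varphi$; equivalently (a fact used in the paper) its Laplace transform satisfies $\Re\hat\beta(s)\ge0$ for $\Re s>0$. The data are $f:[0,\infty)\to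 H$ and $u_0\in H$. *)

theory Defs
  imports "HOL-Analysis.Analysis"
begin

definition sq_integrable :: "('a::euclidean_space \<Rightarrow> real) \<Rightarrow> bool" where
  "sq_integrable f \<longleftrightarrow> f \<in> borel_measurable lebesgue \<and> integrable lebesgue (\<lambda>x. (f x)\<^sup>2)"

lemma sq_integrable_measurable [measurable_dest]: "sq_integrable f \<Longrightarrow> f \<in> borel_measurable lebesgue"
  by (simp add: sq_integrable_def)

lemma sq_integrable_bound:
  assumes "f \<in> borel_measurable lebesgue" "integrable lebesgue w"
    and "\<And>x. (f x)\<^sup>2 \<le> w x"
  shows "sq_integrable f"
  unfolding sq_integrable_def
proof
  show "integrable lebesgue (\<lambda>x. (f x)\<^sup>2)"
    by (rule Bochner_Integration.integrable_bound[OF assms(2)])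
      (use assms(1,3) in \<open>auto intro: order_trans[OF _ abs_ge_self]\<close>)
qed (fact assms(1))

lemma sq_integrable_mult:
  assumes "sq_integrable f" "sq_integrable g"
  shows "integrable lebesgue (\<lambda>x. f x * g x)"
proof (rule Bochner_Integration.integrable_bound)
  show "integrable lebesgue (\<lambda>x. (f x)\<^sup>2 + (g x)\<^sup>2)"
    using assms by (simp add: sq_integrable_def)
  show "(\<lambda>x. f x * g x) \<in> borel_measurable lebesgue"
    using assms by (auto simp: sq_integrable_def intro!: borel_measurable_times)
  have "\<bar>f x * g x\<bar> \<le> (f x)\<^sup>2 + (g x)\<^sup>2" for x
  proof -
    have "2 * (\<bar>f x\<bar> * \<bar>g x\<bar>) \<le> (f x)\<^sup>2 + (g x)\<^sup>2"
      using sum_squares_bound[of "\<bar>f x\<bar>" "\<bar>g x\<bar>"] by (simp add: mult.assoc)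
    moreover have "0 \<le> \<bar>f x\<bar> * \<bar>g x\<bar>" by simp
    ultimately show ?thesis unfolding abs_mult by linarith
  qed
  then show "AE x in lebesgue. norm (f x * g x) \<le> norm ((f x)\<^sup>2 + (g x)\<^sup>2)"
    by (simp add: abs_mult)
qed

lemma sq_integrable_add:
  assumes "sq_integrable f" "sq_integrable g"
  shows "sq_integrable (\<lambda>x. f x + g x)"
proof (rule sq_integrable_bound)
  show "integrable lebesgue (\<lambda>x. (f x)\<^sup>2 + 2 * (f x * g x) + (g x)\<^sup>2)"
    using assms sq_integrable_mult[OF assms] by (simp add: sq_integrable_def)
qed (use assms in \<open>auto simp: sq_integrable_def power2_sum\<close>)

lemma sq_integrable_scale: "sq_integrable f \<Longrightarrow> sq_integrable (\<lambda>x. c * f x)"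
  by (auto simp: sq_integrable_def power_mult_distrib)

lemma sq_integrable_uminus: "sq_integrable f \<Longrightarrow> sq_integrable (\<lambda>x. - f x)"
  using sq_integrable_scale[of f "-1"] by simp

lemma sq_integrable_diff: "sq_integrable f \<Longrightarrow> sq_integrable g \<Longrightarrow> sq_integrable (\<lambda>x. f x - g x)"
  using sq_integrable_add[OF _ sq_integrable_uminus, of f g] by simp

lemma sq_integrable_zero: "sq_integrable (\<lambda>x. 0)"
  by (simp add: sq_integrable_def)

definition L2_rel :: "('a::euclidean_space \<Rightarrow> real) \<Rightarrow> ('a \<Rightarrow> real) \<Rightarrow> bool" where
  "L2_rel f g \<longleftrightarrow> sq_integrable f \<and> sq_integrable g \<and> (AE x in lebesgue. f x = g x)"

quotient_type (overloaded) 'a L2 = "'a::euclidean_space \<Rightarrow> real" / partial: L2_rel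
proof (rule part_equivpI)
  show "\<exists>f :: 'a \<Rightarrow> real. L2_rel f f"
    by (rule exI[of _ "\<lambda>x. 0"]) (simp add: L2_rel_def sq_integrable_zero)
  show "symp (L2_rel :: ('a \<Rightarrow> real) \<Rightarrow> _)"
    by (auto simp: symp_def L2_rel_def elim: eventually_mono)
  show "transp (L2_rel :: ('a \<Rightarrow> real) \<Rightarrow> _)"
    unfolding transp_def L2_rel_def
    by (auto elim: eventually_elim2)
qed

lemma L2_integral_cong:
  assumes "L2_rel f f'" "L2_rel g g'"
  shows "(LINT x|lebesgue. f x * g x) = (LINT x|lebesgue. f' x * g' x)"
proof (rule integral_cong_AE)
  show "AE x in lebesgue. f x * g x = f' x * g' x"
    using assms by (auto simp: L2_rel_def elim: eventually_elim2)
qed (use assms in \<open>auto simp: L2_rel_def sq_integrable_def\<close>)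

instantiation L2 :: (euclidean_space) real_inner
begin

lift_definition zero_L2 :: "'a L2" is "\<lambda>x. 0"
  by (simp add: L2_rel_def sq_integrable_zero)

lift_definition plus_L2 :: "'a L2 \<Rightarrow> 'a L2 \<Rightarrow> 'a L2" is "\<lambda>f g x. f x + g x"
  by (auto simp: L2_rel_def sq_integrable_add elim: eventually_elim2)

lift_definition uminus_L2 :: "'a L2 \<Rightarrow> 'a L2" is "\<lambda>f x. - f x"
  by (auto simp: L2_rel_def sq_integrable_uminus)

lift_definition minus_L2 :: "'a L2 \<Rightarrow> 'a L2 \<Rightarrow> 'a L2" is "\<lambda>f g x. f x - g x"
  by (auto simp: L2_rel_def sq_integrable_diff elim: eventually_elim2)

lift_definition scaleR_L2 :: "real \<Rightarrow> 'a L2 \<Rightarrow> 'a L2" is "\<lambda>c f x. c * f x"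
  by (auto simp: L2_rel_def sq_integrable_scale elim: eventually_mono)

lift_definition inner_L2 :: "'a L2 \<Rightarrow> 'a L2 \<Rightarrow> real" is "\<lambda>f g. LINT x|lebesgue. f x * g x"
  by (rule L2_integral_cong)

definition norm_L2 :: "'a L2 \<Rightarrow> real" where "norm_L2 f = sqrt (inner f f)"

definition dist_L2 :: "'a L2 \<Rightarrow> 'a L2 \<Rightarrow> real" where "dist_L2 f g = norm (f - g)"

definition sgn_L2 :: "'a L2 \<Rightarrow> 'a L2" where "sgn_L2 f = inverse (norm f) *\<^sub>R f"

definition uniformity_L2 :: "('a L2 \<times> 'a L2) filter"
  where [code del]: "uniformity_L2 = (INF e\<in>{0<..}. principal {(f, g). dist f g < e})"

definition open_L2 :: "'a L2 set \<Rightarrow> bool"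
  where [code del]: "open_L2 U \<longleftrightarrow> (\<forall>f\<in>U. eventually (\<lambda>(f', g). f' = f \<longrightarrow> g \<in> U) uniformity)"

instance
proof
  fix a b c :: "'a L2" and r s :: real and U :: "'a L2 set"
  show "a + b + c = a + (b + c)"
    by transfer (auto simp: L2_rel_def algebra_simps intro!: sq_integrable_add)
  show "a + b = b + a"
    by transfer (auto simp: L2_rel_def algebra_simps intro!: sq_integrable_add)
  show "0 + a = a"
    by transfer (auto simp: L2_rel_def)
  show "- a + a = 0"
    by transfer (auto simp: L2_rel_def sq_integrable_zero)
  show "a - b = a + - b"
    by transfer (auto simp: L2_rel_def sq_integrable_diff)
  show "r *\<^sub>R (a + b) = r *\<^sub>R a + r *\<^sub>R b"
    by transfer (auto simp: L2_rel_def distrib_left sq_integrable_add sq_integrable_scale)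
  show "(r + s) *\<^sub>R a = r *\<^sub>R a + s *\<^sub>R a"
    by transfer (auto simp: L2_rel_def distrib_right sq_integrable_add sq_integrable_scale)
  show "r *\<^sub>R s *\<^sub>R a = (r * s) *\<^sub>R a"
    by transfer (auto simp: L2_rel_def mult.assoc sq_integrable_scale)
  show "1 *\<^sub>R a = a"
    by transfer (auto simp: L2_rel_def)
  show "dist a b = norm (a - b)" by (simp add: dist_L2_def)
  show "sgn a = inverse (norm a) *\<^sub>R a" by (simp add: sgn_L2_def)
  show "uniformity = (INF e\<in>{0<..}. principal {(f, g :: 'a L2). dist f g < e})"
    by (simp add: uniformity_L2_def)
  show "open U \<longleftrightarrow> (\<forall>f\<in>U. eventually (\<lambda>(f', g). f' = f \<longrightarrow> g \<in> U) uniformity)"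
    by (simp add: open_L2_def)
  show "inner a b = inner b a"
    by transfer (simp add: mult.commute)
  show "inner (a + b) c = inner a c + inner b c"
    by transfer (simp add: distrib_right L2_rel_def sq_integrable_mult)
  show "inner (r *\<^sub>R a) b = r * inner a b"
    by transfer (simp add: mult.assoc)
  show "0 \<le> inner a a"
    by transfer (simp add: integral_nonneg_AE)
  show "inner a a = 0 \<longleftrightarrow> a = 0"
  proof (transfer, unfold L2_rel_def, elim conjE)
    fix f :: "'a \<Rightarrow> real"
    assume f: "sq_integrable f"
    then have "integrable lebesgue (\<lambda>x. f x * f x)" using f by (intro sq_integrable_mult)
    then have "(LINT x|lebesgue. f x * f x) = 0 \<longleftrightarrow> (AE x in lebesgue. f x * f x = 0)"
      by (subst integral_nonneg_eq_0_iff_AE) auto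
    then show "((LINT x|lebesgue. f x * f x) = 0) =
        (sq_integrable f \<and> sq_integrable (\<lambda>x::'a. 0) \<and> (AE x in lebesgue. f x = 0))"
      using f by (simp add: sq_integrable_zero)
  qed
  show "norm a = sqrt (inner a a)" by (simp add: norm_L2_def)
qed

end


lemma abs_L2_surj: obtains g where "sq_integrable g" "f = abs_L2 g"
proof -
  have "L2_rel (rep_L2 f) (rep_L2 f)" "abs_L2 (rep_L2 f) = f"
    using Quotient_rep_reflp[OF Quotient_L2] Quotient_abs_rep[OF Quotient_L2] by auto
  with that show thesis by (metis L2_rel_def)
qed

lemma abs_L2_eqI: "sq_integrable f \<Longrightarrow> sq_integrable g \<Longrightarrow> AE x in lebesgue. f x = g x \<Longrightarrow> abs_L2 f = abs_L2 g"
  using Quotient_rel_abs[OF Quotient_L2] by (auto simp: L2_rel_def)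

lemma abs_L2_arith:
  assumes "sq_integrable f" "sq_integrable g"
  shows "abs_L2 f + abs_L2 g = abs_L2 (\<lambda>x. f x + g x)"
    "abs_L2 f - abs_L2 g = abs_L2 (\<lambda>x. f x - g x)"
    "c *\<^sub>R abs_L2 f = abs_L2 (\<lambda>x. c * f x)"
    "inner (abs_L2 f) (abs_L2 g) = (LINT x|lebesgue. f x * g x)"
  using assms
  by (simp_all add: plus_L2.abs_eq minus_L2.abs_eq scaleR_L2.abs_eq inner_L2.abs_eq L2_rel_def)

lemma norm_abs_L2: "sq_integrable f \<Longrightarrow> (norm (abs_L2 f))\<^sup>2 = (LINT x|lebesgue. (f x)\<^sup>2)"
  by (simp add: power2_norm_eq_inner abs_L2_arith) (simp add: power2_eq_square)

lemma norm_diff_abs_L2: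
  "sq_integrable f \<Longrightarrow> sq_integrable g \<Longrightarrow> (norm (abs_L2 f - abs_L2 g))\<^sup>2 = (LINT x|lebesgue. (f x - g x)\<^sup>2)"
  by (simp add: abs_L2_arith norm_abs_L2 sq_integrable_diff)

lemma nn_integral_abs_L2:
  assumes "sq_integrable f"
  shows "(\<integral>\<^sup>+x. ennreal ((f x)\<^sup>2) \<partial>lebesgue) = ennreal ((norm (abs_L2 f))\<^sup>2)"
  using assms by (simp add: norm_abs_L2 nn_integral_eq_integral sq_integrable_def)

lemma ex_positive_weight: "\<exists>w::'a::euclidean_space \<Rightarrow> real. sq_integrable w \<and> (\<forall>x. 0 < w x)"
proof -
  obtain h :: "'a \<Rightarrow> ennreal" where h: "h \<in> borel_measurable lborel" "integral\<^sup>N lborel h \<noteq> \<infinity>"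
      "\<And>x. 0 < h x \<and> h x < \<infinity>"
    using sigma_finite_measure.Ex_finite_integrable_function[OF sigma_finite_lborel] by auto
  define w where "w x = sqrt (enn2real (h x))" for x
  have [measurable]: "h \<in> borel_measurable borel" using h(1) by simp
  have wm: "w \<in> borel_measurable borel" unfolding w_def by measurable
  have pos: "0 < w x" for x
    using h(3)[of x] by (simp add: w_def enn2real_positive_iff)
  have eq: "ennreal ((w x)\<^sup>2) = h x" for x
    using h(3)[of x] by (simp add: w_def ennreal_enn2real)
  have "integrable lborel (\<lambda>x. (w x)\<^sup>2)"
    using h(2) wm by (intro integrableI_bounded) (auto simp: eq top.not_eq_extremum)
  then have "integrable lebesgue (\<lambda>x. (w x)\<^sup>2)"
    using wm by (subst integrable_completion) auto
  then have "sq_integrable w"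
    using wm by (auto simp: sq_integrable_def intro: measurable_completion)
  with pos show ?thesis by blast
qed

instance L2 :: (euclidean_space) complete_space
proof
  fix X :: "nat \<Rightarrow> 'a L2"
  assume X: "Cauchy X"
  have "\<exists>g. sq_integrable g \<and> X n = abs_L2 g" for n
    by (rule abs_L2_surj[of "X n"]) blast
  then obtain r where r: "\<And>n. sq_integrable (r n)" "\<And>n. X n = abs_L2 (r n)"
    by metis
  have [measurable]: "r n \<in> borel_measurable lebesgue" for n
    using r(1) by (simp add: sq_integrable_def)
  obtain w :: "'a \<Rightarrow> real" where w: "sq_integrable w" "\<And>x. 0 < w x"
    using ex_positive_weight by auto
  define W where "W = norm (abs_L2 w)"
  define s where "s n x = r n x * w x" for n x
  have l1: "(LINT x|lebesgue. norm (s i x - s j x)) \<le> norm (X i - X j) * W" for i j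
  proof -
    define d where "d x = \<bar>r i x - r j x\<bar>" for x
    have "d \<in> borel_measurable lebesgue" unfolding d_def by measurable
    then have d: "sq_integrable d"
      using sq_integrable_diff[OF r(1)[of i] r(1)[of j]] by (simp add: sq_integrable_def d_def)
    have "(LINT x|lebesgue. norm (s i x - s j x)) = inner (abs_L2 d) (abs_L2 w)"
      using d w by (simp add: abs_L2_arith s_def d_def abs_mult less_imp_le flip: left_diff_distrib)
    also have "\<dots> \<le> norm (abs_L2 d) * W"
      unfolding W_def by (rule norm_cauchy_schwarz)
    also have "(norm (abs_L2 d))\<^sup>2 = (norm (X i - X j))\<^sup>2"
      using d r by (simp add: norm_abs_L2 norm_diff_abs_L2 d_def)
    then have "norm (abs_L2 d) = norm (X i - X j)"
      by (simp add: power2_eq_iff_nonneg)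
    finally show ?thesis .
  qed
  obtain \<rho> where \<rho>: "strict_mono \<rho>" "AE x in lebesgue. Cauchy (\<lambda>i. s (\<rho> i) x)"
  proof (rule cauchy_L1_AE_cauchy_subseq[of lebesgue s])
    show "integrable lebesgue (s n)" for n
      unfolding s_def using r w by (intro sq_integrable_mult)
    fix e :: real assume e: "0 < e"
    have "0 \<le> W" by (simp add: W_def)
    with e have "0 < e / (W + 1)" by simp
    with X obtain N where N: "\<And>i j. i \<ge> N \<Longrightarrow> j \<ge> N \<Longrightarrow> norm (X i - X j) < e / (W + 1)"
      by (metis CauchyD)
    have "(LINT x|lebesgue. norm (s i x - s j x)) < e" if "i \<ge> N" "j \<ge> N" for i j
    proof -
      have "norm (X i - X j) * (W + 1) < e"
        using N[OF that] \<open>0 \<le> W\<close> by (simp add: field_simps)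
      moreover have "norm (X i - X j) * W \<le> norm (X i - X j) * (W + 1)"
        by (intro mult_left_mono) auto
      ultimately show ?thesis using l1[of i j] by linarith
    qed
    then show "\<exists>N. \<forall>i\<ge>N. \<forall>j\<ge>N. (LINT x|lebesgue. norm (s i x - s j x)) < e" by blast
  qed (use that in auto)
  define F where "F x = lim (\<lambda>i. r (\<rho> i) x)" for x
  have Fm [measurable]: "F \<in> borel_measurable lebesgue"
    unfolding F_def by (rule borel_measurable_lim_metric) measurable
  have F: "AE x in lebesgue. (\<lambda>i. r (\<rho> i) x) \<longlonglongrightarrow> F x"
    using \<rho>(2)
  proof eventually_elim
    fix x assume "Cauchy (\<lambda>i. s (\<rho> i) x)"
    then obtain l where "(\<lambda>i. s (\<rho> i) x) \<longlonglongrightarrow> l"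
      by (auto simp: Cauchy_convergent_iff convergent_def)
    then have "(\<lambda>i. s (\<rho> i) x / w x) \<longlonglongrightarrow> l / w x"
      using w(2)[of x] by (intro tendsto_divide tendsto_const) auto
    moreover have "s (\<rho> i) x / w x = r (\<rho> i) x" for i
      using w(2)[of x] by (simp add: s_def)
    ultimately show "(\<lambda>i. r (\<rho> i) x) \<longlonglongrightarrow> F x"
      by (simp add: F_def limI)
  qed
  have fatou: "(\<integral>\<^sup>+x. ennreal ((F x - r m x)\<^sup>2) \<partial>lebesgue) \<le> ennreal (e\<^sup>2)"
    if N: "\<And>n. n \<ge> N \<Longrightarrow> norm (X n - X m) \<le> e" and "0 \<le> e" for m N e
  proof -
    have "(\<integral>\<^sup>+x. ennreal ((F x - r m x)\<^sup>2) \<partial>lebesgue)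
        = (\<integral>\<^sup>+x. liminf (\<lambda>i. ennreal ((r (\<rho> i) x - r m x)\<^sup>2)) \<partial>lebesgue)"
    proof (rule nn_integral_cong_AE, use F in eventually_elim)
      fix x assume "(\<lambda>i. r (\<rho> i) x) \<longlonglongrightarrow> F x"
      then have "(\<lambda>i. ennreal ((r (\<rho> i) x - r m x)\<^sup>2)) \<longlonglongrightarrow> ennreal ((F x - r m x)\<^sup>2)"
        by (intro tendsto_intros)
      from lim_imp_Liminf[OF _ this]
      show "ennreal ((F x - r m x)\<^sup>2) = liminf (\<lambda>i. ennreal ((r (\<rho> i) x - r m x)\<^sup>2))"
        by simp
    qed
    also have "\<dots> \<le> liminf (\<lambda>i. \<integral>\<^sup>+x. ennreal ((r (\<rho> i) x - r m x)\<^sup>2) \<partial>lebesgue)"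
      by (rule nn_integral_liminf) measurable
    also have "\<dots> \<le> liminf (\<lambda>i::nat. ennreal (e\<^sup>2))"
    proof (rule Liminf_mono)
      have "(\<integral>\<^sup>+x. ennreal ((r (\<rho> i) x - r m x)\<^sup>2) \<partial>lebesgue) \<le> ennreal (e\<^sup>2)" if "i \<ge> N" for i
      proof -
        have "i \<le> \<rho> i" using \<rho>(1) by (rule seq_suble)
        then have "norm (X (\<rho> i) - X m) \<le> e" using that by (intro N) simp
        then have "(norm (X (\<rho> i) - X m))\<^sup>2 \<le> e\<^sup>2" by (intro power_mono) auto
        then show ?thesis
          by (simp add: nn_integral_abs_L2 sq_integrable_diff r abs_L2_arith ennreal_leI)
      qed
      then show "\<forall>\<^sub>F i in sequentially. (\<integral>\<^sup>+x. ennreal ((r (\<rho> i) x - r m x)\<^sup>2) \<partial>lebesgue) \<le> ennreal (e\<^sup>2)"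
        by (auto simp: eventually_sequentially)
    qed
    also have "\<dots> = ennreal (e\<^sup>2)" by (simp add: Liminf_const)
    finally show ?thesis .
  qed
  have sqd: "sq_integrable (\<lambda>x. F x - r m x)"
    if N: "\<And>n. n \<ge> N \<Longrightarrow> norm (X n - X m) \<le> e" and "0 \<le> e" for m N e
    unfolding sq_integrable_def
  proof
    have "(\<integral>\<^sup>+x. ennreal ((F x - r m x)\<^sup>2) \<partial>lebesgue) < \<infinity>"
      using fatou[OF that] by (rule order.strict_trans1) auto
    then show "integrable lebesgue (\<lambda>x. (F x - r m x)\<^sup>2)"
      by (intro integrableI_bounded) auto
  qed measurable
  obtain N1 where N1: "\<And>i j. i \<ge> N1 \<Longrightarrow> j \<ge> N1 \<Longrightarrow> norm (X i - X j) < 1"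
    using X by (metis CauchyD zero_less_one)
  have "sq_integrable (\<lambda>x. (F x - r N1 x) + r N1 x)"
    by (intro sq_integrable_add r(1) sqd[of N1 N1 1]) (auto intro!: less_imp_le N1)
  then have Fsq: "sq_integrable F" by simp
  have "X \<longlonglongrightarrow> abs_L2 F"
  proof (rule LIMSEQ_I)
    fix e :: real assume e: "0 < e"
    then obtain N where N: "\<And>i j. i \<ge> N \<Longrightarrow> j \<ge> N \<Longrightarrow> norm (X i - X j) < e / 2"
      using X by (metis CauchyD half_gt_zero)
    have "norm (X m - abs_L2 F) < e" if m: "m \<ge> N" for m
    proof -
      have "ennreal ((norm (abs_L2 F - X m))\<^sup>2) \<le> ennreal ((e / 2)\<^sup>2)"
        using fatou[of N m "e / 2"] N m e
        by (simp add: nn_integral_abs_L2 sq_integrable_diff r Fsq abs_L2_arith less_imp_le)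
      then have "norm (abs_L2 F - X m) \<le> e / 2"
        using e by (simp add: ennreal_le_iff power2_le_iff_abs_le)
      with e show ?thesis by (simp add: norm_minus_commute)
    qed
    then show "\<exists>N. \<forall>m\<ge>N. norm (X m - abs_L2 F) < e" by blast
  qed
  then show "convergent X" by (auto simp: convergent_def)
qed

instance L2 :: (euclidean_space) banach ..

lemma abs_L2_tendsto:
  assumes g: "\<And>n. g n \<in> borel_measurable lebesgue" and f: "f \<in> borel_measurable lebesgue"
    and h: "sq_integrable h" and bound: "\<And>n x. \<bar>g n x\<bar> \<le> \<bar>h x\<bar>"
    and lim: "\<And>x. (\<lambda>n. g n x) \<longlonglongrightarrow> f x"
  shows "sq_integrable (g n)" "sq_integrable f" "(\<lambda>n. abs_L2 (g n)) \<longlonglongrightarrow> abs_L2 f"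
proof -
  have hi: "integrable lebesgue (\<lambda>x. (h x)\<^sup>2)" using h by (simp add: sq_integrable_def)
  have bf: "\<bar>f x\<bar> \<le> \<bar>h x\<bar>" for x
    by (rule LIMSEQ_le_const2[OF tendsto_rabs[OF lim]]) (use bound in auto)
  show gs: "sq_integrable (g n)" for n
    using g hi by (rule sq_integrable_bound) (use bound in \<open>simp add: abs_le_square_iff\<close>)
  show fs: "sq_integrable f"
    using f hi by (rule sq_integrable_bound) (use bf in \<open>simp add: abs_le_square_iff\<close>)
  have "(\<lambda>n. LINT x|lebesgue. (g n x - f x)\<^sup>2) \<longlonglongrightarrow> (LINT x::'a|lebesgue. 0)"
  proof (rule integral_dominated_convergence)
    show "integrable lebesgue (\<lambda>x. 4 * (h x)\<^sup>2)" using hi by simp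
    show "(\<lambda>x. (g n x - f x)\<^sup>2) \<in> borel_measurable lebesgue" for n
      using g f by (intro borel_measurable_power borel_measurable_diff)
    show "AE x in lebesgue. (\<lambda>n. (g n x - f x)\<^sup>2) \<longlonglongrightarrow> 0"
    proof (rule AE_I2)
      fix x :: 'a
      have "(\<lambda>n. (g n x - f x)\<^sup>2) \<longlonglongrightarrow> (f x - f x)\<^sup>2" by (intro tendsto_intros lim)
      then show "(\<lambda>n. (g n x - f x)\<^sup>2) \<longlonglongrightarrow> 0" by simp
    qed
    show "AE x in lebesgue. norm ((g n x - f x)\<^sup>2) \<le> 4 * (h x)\<^sup>2" for n
    proof (rule AE_I2)
      fix x :: 'a
      have "\<bar>g n x - f x\<bar> \<le> \<bar>2 * h x\<bar>" using bound[of n x] bf[of x] by linarith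
      then have "(g n x - f x)\<^sup>2 \<le> (2 * h x)\<^sup>2" by (simp add: abs_le_square_iff)
      then show "norm ((g n x - f x)\<^sup>2) \<le> 4 * (h x)\<^sup>2" by (simp add: power_mult_distrib)
    qed
  qed simp
  then have "(\<lambda>n. (norm (abs_L2 (g n) - abs_L2 f))\<^sup>2) \<longlonglongrightarrow> 0"
    by (simp add: norm_diff_abs_L2 gs fs)
  then have "(\<lambda>n. sqrt ((norm (abs_L2 (g n) - abs_L2 f))\<^sup>2)) \<longlonglongrightarrow> sqrt 0"
    by (rule tendsto_real_sqrt)
  then show "(\<lambda>n. abs_L2 (g n)) \<longlonglongrightarrow> abs_L2 f"
    by (simp add: LIM_zero_iff tendsto_norm_zero_iff)
qed

lemma countable_Int_stable_generator:
  "\<exists>G :: 'a::euclidean_space set set. countable G \<and> Int_stable G \<and> sets borel = sigma_sets UNIV G"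
proof -
  obtain B :: "'a set set" where B: "countable B" "topological_basis B"
    using ex_countable_basis by auto
  define G where "G = Inter ` {F. finite F \<and> F \<subseteq> B}"
  have "countable G"
    unfolding G_def using B(1) by (intro countable_image countable_Collect_finite_subset)
  moreover have "Int_stable G"
    unfolding Int_stable_def G_def
  proof clarsimp
    fix E F assume "finite E" "E \<subseteq> B" "finite F" "F \<subseteq> B"
    then show "\<Inter> E \<inter> \<Inter> F \<in> Inter ` {F. finite F \<and> F \<subseteq> B}"
      by (intro image_eqI[of _ _ "E \<union> F"]) auto
  qed
  moreover have "sets borel = sigma_sets UNIV G"
  proof -
    have b: "sets borel = sigma_sets UNIV B"
      by (subst borel_eq_countable_basis[OF B]) simp
    have "B \<subseteq> G"
      unfolding G_def by (auto intro!: image_eqI[of _ Inter "{x}" for x])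
    then have "sigma_sets UNIV B \<subseteq> sigma_sets UNIV G"
      by (intro sigma_sets_mono) auto
    moreover have "G \<subseteq> sets borel"
    proof
      fix A assume "A \<in> G"
      then obtain F where F: "finite F" "F \<subseteq> B" "A = \<Inter> F" by (auto simp: G_def)
      then have "open A" using topological_basis_open[OF B(2)] by (auto intro: open_Inter)
      then show "A \<in> sets borel" by simp
    qed
    then have "sigma_sets UNIV G \<subseteq> sets borel"
      using sets.sigma_sets_subset[of G borel] by simp
    ultimately show ?thesis using b by simp
  qed
  ultimately show ?thesis by blast
qed

lemma L2_separable: "\<exists>D :: 'a::euclidean_space L2 set. countable D \<and> closure D = UNIV"
proof -
  obtain G :: "'a set set" where G: "countable G" "Int_stable G" "sets borel = sigma_sets UNIV G"
    using countable_Int_stable_generator by auto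
  define K :: "nat \<Rightarrow> 'a set" where "K k = cball 0 (real k)" for k
  have K: "sq_integrable (indicator (K k) :: 'a \<Rightarrow> real)" for k
    unfolding sq_integrable_def
  proof
    have *: "(indicator (K k) x)\<^sup>2 = (indicator (K k) x :: real)" for x :: 'a
      by (simp add: indicator_def)
    show "integrable lebesgue (\<lambda>x. (indicator (K k) x :: real)\<^sup>2)"
      using lmeasurable_cball[of 0 "real k"] unfolding * by (simp add: K_def lmeasurable_iff_integrable)
  qed (simp add: K_def borel_measurable_indicator)
  define E where "E = (\<lambda>(A, k). abs_L2 (indicator (A \<inter> K k) :: 'a \<Rightarrow> real)) ` (insert UNIV G \<times> UNIV)"
  define D where "D = sum_list ` lists ((\<lambda>(q, e). of_rat q *\<^sub>R e) ` (UNIV \<times> E))"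
  have "countable E" unfolding E_def using G(1) by (intro countable_image countable_SIGMA) auto
  then have cD: "countable D"
    unfolding D_def by (intro countable_image countable_lists countable_SIGMA) auto
  let ?S = "closure D"
  have D_add: "of_rat q *\<^sub>R e + d \<in> D" if "e \<in> E" "d \<in> D" for q e d
  proof -
    from \<open>d \<in> D\<close> obtain xs where xs: "xs \<in> lists ((\<lambda>(q, e). of_rat q *\<^sub>R e) ` (UNIV \<times> E))" "d = sum_list xs"
      by (auto simp: D_def)
    show ?thesis unfolding D_def
      by (rule image_eqI[of _ _ "(of_rat q *\<^sub>R e) # xs"]) (use xs that in auto)
  qed
  have S_add: "c *\<^sub>R e + x \<in> ?S" if e: "e \<in> E" and x: "x \<in> ?S" for c :: real and e x
  proof -
    from x obtain d where d: "\<And>n. d n \<in> D" "d \<longlonglongrightarrow> x"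
      by (auto simp: closure_sequential)
    have "c \<in> closure \<rat>" by (simp add: Rats_closure_real)
    then obtain q' where q': "\<And>n. q' n \<in> \<rat>" "q' \<longlonglongrightarrow> c"
      by (auto simp: closure_sequential)
    have "\<exists>p. q' n = of_rat p" for n using q'(1)[of n] by (auto elim: Rats_cases)
    then obtain q where q: "\<And>n. q' n = of_rat (q n)" by metis
    have "(\<lambda>n. q' n *\<^sub>R e + d n) \<longlonglongrightarrow> c *\<^sub>R e + x"
      by (intro tendsto_intros q' d)
    moreover have "q' n *\<^sub>R e + d n \<in> D" for n
      unfolding q by (rule D_add) (use e d in auto)
    ultimately show ?thesis unfolding closure_sequential by (intro exI conjI allI)
  qed
  have "0 \<in> D" unfolding D_def by (rule image_eqI[of _ _ "[]"]) auto
  then have "0 \<in> ?S" using closure_subset by auto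
  then have "span E \<subseteq> ?S"
    by (auto elim!: span_induct_alt intro: S_add)
  then have cl: "closure (span E) \<subseteq> ?S" by (simp add: closure_minimal)
  define V where "V = closure (span E)"
  have Vlim: "x \<in> V" if "\<And>n. X n \<in> V" "X \<longlonglongrightarrow> x" for X x
    using that unfolding V_def by (rule closed_sequentially[OF closed_closure])
  have Vadd: "x + y \<in> V" if xy: "x \<in> V" "y \<in> V" for x y
  proof -
    obtain a b where "\<And>n. a n \<in> span E" "a \<longlonglongrightarrow> x" "\<And>n. b n \<in> span E" "b \<longlonglongrightarrow> y"
      using xy by (auto simp: V_def closure_sequential)
    then show ?thesis
      by (auto simp: V_def closure_sequential intro!: exI[of _ "\<lambda>n. a n + b n"] span_add tendsto_add)
  qed
  have Vscale: "c *\<^sub>R x \<in> V" if x: "x \<in> V" for c x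
  proof -
    obtain a where "\<And>n. a n \<in> span E" "a \<longlonglongrightarrow> x"
      using x by (auto simp: V_def closure_sequential)
    then show ?thesis
      by (auto simp: V_def closure_sequential intro!: exI[of _ "\<lambda>n. c *\<^sub>R a n"] span_scale tendsto_intros)
  qed
  have Vdiff: "x - y \<in> V" if "x \<in> V" "y \<in> V" for x y
    using Vadd[OF that(1) Vscale[OF that(2), of "-1"]] by simp
  have VE: "E \<subseteq> V" unfolding V_def using span_superset closure_subset by blast
  have VEI: "abs_L2 (indicator (A \<inter> K k) :: 'a \<Rightarrow> real) \<in> V" if "A \<in> insert UNIV G" for A k
    using that by (intro subsetD[OF VE]) (auto simp: E_def intro!: image_eqI[of _ _ "(A, k)"])
  have V0: "0 \<in> V" unfolding V_def using span_zero closure_subset by blast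
  have Kb: "K k \<in> sets borel" for k by (simp add: K_def)
  have isq: "sq_integrable (indicator (A \<inter> K k) :: 'a \<Rightarrow> real)" if "A \<in> sets borel" for A k
  proof (rule sq_integrable_bound)
    show "integrable lebesgue (\<lambda>x. (indicator (K k) x :: real)\<^sup>2)" using K by (simp add: sq_integrable_def)
    show "(indicator (A \<inter> K k) :: 'a \<Rightarrow> real) \<in> borel_measurable lebesgue"
      using that Kb[of k] by (intro borel_measurable_indicator) auto
  qed (auto simp: indicator_def)
  have ind: "abs_L2 (indicator (A \<inter> K k) :: 'a \<Rightarrow> real) \<in> V" if A: "A \<in> sets borel" for A k
  proof -
    have "G \<subseteq> Pow UNIV" "A \<in> sigma_sets UNIV G" using A G(3) by auto
    with G(2) show ?thesis
    proof (induction rule: sigma_sets_induct_disjoint)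
      case (basic A)
      then show ?case by (intro VEI) simp
    next
      case empty
      have "abs_L2 (\<lambda>x::'a. 0) = 0" by (simp add: zero_L2.abs_eq)
      then show ?case using V0 by (simp add: indicator_def)
    next
      case (compl A)
      then have Ab: "A \<in> sets borel" using G(3) by simp
      have "abs_L2 (indicator (UNIV \<inter> K k) :: 'a \<Rightarrow> real) \<in> V" by (intro VEI) simp
      then have "abs_L2 (indicator (UNIV \<inter> K k) :: 'a \<Rightarrow> real) - abs_L2 (indicator (A \<inter> K k) :: 'a \<Rightarrow> real) \<in> V"
        using compl by (intro Vdiff)
      also have "abs_L2 (indicator (UNIV \<inter> K k) :: 'a \<Rightarrow> real) - abs_L2 (indicator (A \<inter> K k) :: 'a \<Rightarrow> real)
          = abs_L2 (\<lambda>x. indicator (UNIV \<inter> K k) x - indicator (A \<inter> K k) x)"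
        by (intro abs_L2_arith isq Ab) simp
      also have "(\<lambda>x. indicator (UNIV \<inter> K k) x - indicator (A \<inter> K k) x) = (indicator ((UNIV - A) \<inter> K k) :: 'a \<Rightarrow> real)"
        by (auto simp: indicator_def)
      finally show ?case .
    next
      case (union A)
      then have Ab: "A i \<in> sets borel" for i using G(3) by auto
      have fin: "abs_L2 (indicator ((\<Union>i<n. A i) \<inter> K k) :: 'a \<Rightarrow> real) \<in> V" for n :: nat
      proof (induction n)
        case 0
        have "abs_L2 (\<lambda>x::'a. 0) = 0" by (simp add: zero_L2.abs_eq)
        then show ?case using V0 by (simp add: indicator_def)
      next
        case (Suc n)
        have eq: "(indicator ((\<Union>i<Suc n. A i) \<inter> K k) :: 'a \<Rightarrow> real)
            = (\<lambda>x. indicator ((\<Union>i<n. A i) \<inter> K k) x + indicator (A n \<inter> K k) x)"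
        proof
          fix x :: 'a
          have "\<not> (x \<in> A n \<and> x \<in> A i)" if "i < n" for i
            using union(1) that disjoint_family_onD[of A UNIV n i] by auto
          then show "(indicator ((\<Union>i<Suc n. A i) \<inter> K k) x :: real)
              = indicator ((\<Union>i<n. A i) \<inter> K k) x + indicator (A n \<inter> K k) x"
            by (auto simp: indicator_def less_Suc_eq)
        qed
        have "abs_L2 (indicator ((\<Union>i<n. A i) \<inter> K k) :: 'a \<Rightarrow> real) + abs_L2 (indicator (A n \<inter> K k) :: 'a \<Rightarrow> real) \<in> V"
          using Suc union by (intro Vadd) auto
        also have "abs_L2 (indicator ((\<Union>i<n. A i) \<inter> K k) :: 'a \<Rightarrow> real) + abs_L2 (indicator (A n \<inter> K k) :: 'a \<Rightarrow> real)
          = abs_L2 (\<lambda>x. indicator ((\<Union>i<n. A i) \<inter> K k) x + indicator (A n \<inter> K k) x)"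
          by (intro abs_L2_arith isq Ab sets.finite_UN) (auto simp: Ab)
        finally show ?case unfolding eq .
      qed
      have Ub: "(\<Union>i. A i) \<in> sets borel" using Ab by auto
      have "(\<lambda>n. abs_L2 (indicator ((\<Union>i<n. A i) \<inter> K k) :: 'a \<Rightarrow> real)) \<longlonglongrightarrow> abs_L2 (indicator ((\<Union>i. A i) \<inter> K k))"
      proof (rule abs_L2_tendsto(3)[OF _ _ K[of k]])
        show "(indicator ((\<Union>i<n. A i) \<inter> K k) :: 'a \<Rightarrow> real) \<in> borel_measurable lebesgue" for n :: nat
          using isq[of "\<Union>i<n. A i" k] Ab by (auto simp: sq_integrable_def)
        show "(indicator ((\<Union>i. A i) \<inter> K k) :: 'a \<Rightarrow> real) \<in> borel_measurable lebesgue"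
          using isq[OF Ub] by (auto simp: sq_integrable_def)
        show "\<bar>indicator ((\<Union>i<n. A i) \<inter> K k) x :: real\<bar> \<le> \<bar>indicator (K k) x\<bar>" for n x
          by (simp add: indicator_def)
        show "(\<lambda>n. indicator ((\<Union>i<n. A i) \<inter> K k) x :: real) \<longlonglongrightarrow> indicator ((\<Union>i. A i) \<inter> K k) x" for x
        proof (cases "x \<in> (\<Union>i. A i) \<inter> K k")
          case True
          then obtain i where "x \<in> A i" by auto
          then have "indicator ((\<Union>j<n. A j) \<inter> K k) x = (1::real)" if "n > i" for n
            using that True by (auto simp: indicator_def)
          then have "\<forall>\<^sub>F n in sequentially. indicator ((\<Union>j<n. A j) \<inter> K k) x = (1::real)"
            by (intro eventually_mono[OF eventually_gt_at_top[of i]])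
          then show ?thesis using True by (simp add: tendsto_eventually)
        next
          case False
          then have "indicator ((\<Union>j<n. A j) \<inter> K k) x = (0::real)" for n :: nat
            by (auto simp: indicator_def)
          with False show ?thesis by simp
        qed
      qed
      with fin show ?case by (rule Vlim)
    qed
  qed
  have "f \<in> V" for f
  proof -
    obtain g0 where g0: "sq_integrable g0" "f = abs_L2 g0" by (rule abs_L2_surj)
    then obtain g where g: "g \<in> borel_measurable borel" "AE x in lborel. g0 x = g x"
      using completion_ex_borel_measurable_real[of g0 lborel] by (auto simp: sq_integrable_def)
    have ae: "AE x in lebesgue. g0 x = g x" using g(2) by (rule AE_completion)
    have gm: "g \<in> borel_measurable lebesgue" using g(1) by (auto intro: measurable_completion)
    have gs: "sq_integrable g"
      unfolding sq_integrable_def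
    proof
      have "integrable lebesgue (\<lambda>x. (g0 x)\<^sup>2) \<longleftrightarrow> integrable lebesgue (\<lambda>x. (g x)\<^sup>2)"
        using ae gm g0(1) by (intro integrable_cong_AE) (auto simp: sq_integrable_def elim: eventually_mono)
      then show "integrable lebesgue (\<lambda>x. (g x)\<^sup>2)" using g0(1) by (simp add: sq_integrable_def)
    qed (fact gm)
    have fg: "f = abs_L2 g" using g0 gs ae by (auto intro: abs_L2_eqI)
    obtain s where s: "\<And>i. simple_function borel (s i)" "\<And>x. (\<lambda>i. s i x) \<longlonglongrightarrow> g x"
        "\<And>i x. norm (s i x) \<le> 2 * norm (g x)"
      using borel_measurable_implies_sequence_metric[OF g(1), of 0] by auto
    define t where "t i x = s i x * indicator (K i) x" for i x
    have tm: "t i \<in> borel_measurable borel" for i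
      unfolding t_def using borel_measurable_simple_function[OF s(1)[of i]] Kb[of i] by auto
    have tlim: "(\<lambda>i. abs_L2 (t i)) \<longlonglongrightarrow> abs_L2 g"
    proof (rule abs_L2_tendsto(3)[OF _ gm sq_integrable_scale[OF gs, of 2]])
      show "t i \<in> borel_measurable lebesgue" for i using tm by (auto intro: measurable_completion)
      show "\<bar>t i x\<bar> \<le> \<bar>2 * g x\<bar>" for i x
        using s(3)[of i x] by (auto simp: t_def abs_mult indicator_def)
      fix x :: 'a
      obtain k :: nat where k: "norm x \<le> real k" using real_arch_simple by blast
      have "\<forall>\<^sub>F i in sequentially. s i x = t i x"
      proof (rule eventually_mono[OF eventually_ge_at_top[of k]])
        fix i assume "k \<le> i"
        with k have "norm x \<le> real i" by linarith
        then show "s i x = t i x" by (simp add: t_def K_def)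
      qed
      then show "(\<lambda>i. t i x) \<longlonglongrightarrow> g x" using s(2)[of x] by (simp add: tendsto_cong)
    qed
    have "abs_L2 (t i) \<in> V" for i
    proof -
      have fin: "finite (range (s i))" using simple_functionD(1)[OF s(1)[of i]] by simp
      have pre: "s i -` {y} \<in> sets borel" for y using simple_functionD(2)[OF s(1)[of i], of "{y}"] by simp
      define p where "p y x = y * indicator (s i -` {y} \<inter> K i) x" for y x
      have p: "sq_integrable (p y)" "abs_L2 (p y) \<in> V" for y
      proof -
        show "sq_integrable (p y)"
          unfolding p_def by (intro sq_integrable_scale isq pre)
        have "abs_L2 (p y) = y *\<^sub>R abs_L2 (indicator (s i -` {y} \<inter> K i))"
          unfolding p_def by (rule abs_L2_arith(3)[OF isq[OF pre] isq[OF pre], symmetric])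
        then show "abs_L2 (p y) \<in> V" by (simp add: Vscale ind pre)
      qed
      have "sq_integrable (\<lambda>x. \<Sum>y\<in>Y. p y x) \<and> abs_L2 (\<lambda>x. \<Sum>y\<in>Y. p y x) \<in> V" if "finite Y" for Y
        using that
      proof (induction Y rule: finite_induct)
        case empty
        have "abs_L2 (\<lambda>x::'a. 0) = 0" by (simp add: zero_L2.abs_eq)
        then show ?case using V0 by (simp add: sq_integrable_zero)
      next
        case (insert y Y)
        then have "abs_L2 (p y) + abs_L2 (\<lambda>x. \<Sum>y\<in>Y. p y x) \<in> V"
          by (intro Vadd p) auto
        with insert p(1)[of y] show ?case by (simp add: abs_L2_arith sq_integrable_add)
      qed
      from this[OF fin] have "abs_L2 (\<lambda>x. \<Sum>y\<in>range (s i). p y x) \<in> V" by simp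
      also have "(\<lambda>x. \<Sum>y\<in>range (s i). p y x) = t i"
      proof
        fix x :: 'a
        have "(\<Sum>y\<in>range (s i). p y x)
            = (\<Sum>y\<in>range (s i). if y = s i x then s i x * indicator (K i) x else 0)"
          by (intro sum.cong) (auto simp: p_def indicator_def)
        then show "(\<Sum>y\<in>range (s i). p y x) = t i x"
          using fin by (simp add: t_def)
      qed
      finally show ?thesis .
    qed
    from this tlim show ?thesis unfolding fg by (rule Vlim)
  qed
  then have "closure D = UNIV" using cl by (auto simp: V_def)
  with cD show ?thesis by blast
qed

instance L2 :: (euclidean_space) second_countable_topology
proof
  obtain D :: "'a L2 set" where D: "countable D" "closure D = UNIV"
    using L2_separable by blast
  define B where "B = (\<lambda>(d, n). ball d (1 / Suc n)) ` (D \<times> UNIV)"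
  have "countable B" unfolding B_def using D(1) by (intro countable_image countable_SIGMA) auto
  moreover have "topological_basis B"
  proof (rule topological_basisI)
    show "open U" if "U \<in> B" for U using that by (auto simp: B_def)
    fix U and x :: "'a L2"
    assume "open U" "x \<in> U"
    then obtain e where e: "0 < e" "ball x e \<subseteq> U" by (auto simp: open_contains_ball)
    then obtain n where n: "1 / Suc n < e / 2" by (metis half_gt_zero nat_approx_posE)
    have "x \<in> closure D" using D(2) by simp
    then obtain d where d: "d \<in> D" "dist d x < 1 / Suc n"
      unfolding closure_approachable by (metis of_nat_0_less_iff zero_less_Suc zero_less_divide_1_iff)
    have "ball d (1 / Suc n) \<subseteq> ball x e"
    proof
      fix y assume "y \<in> ball d (1 / Suc n)"
      then have "dist d y < 1 / Suc n" by simp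
      moreover have "dist x y \<le> dist d x + dist d y" by (metis dist_commute dist_triangle)
      ultimately have "dist x y < e" using d(2) n by linarith
      then show "y \<in> ball x e" by simp
    qed
    moreover have "x \<in> ball d (1 / Suc n)" using d by simp
    ultimately show "\<exists>V\<in>B. x \<in> V \<and> V \<subseteq> U"
      using d e by (intro bexI[of _ "ball d (1 / Suc n)"]) (auto simp: B_def)
  qed
  ultimately show "\<exists>B::'a L2 set set. countable B \<and> open = generate_topology B"
    using topological_basis_imp_subbasis by blast
qed


lift_definition L2_vanishes_outside :: "'a::euclidean_space set \<Rightarrow> 'a L2 \<Rightarrow> bool"
  is "\<lambda>\<Omega> g. AE x in lebesgue. x \<notin> \<Omega> \<longrightarrow> g x = 0"
  by (rule eventually_subst) (auto simp: L2_rel_def elim: eventually_mono)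

text \<open>
  A type cannot depend on the set \<open>\<Omega>\<close>. The space \<open>L\<^sup>2(\<Omega>)\<close> is the closed subspace of \<open>L\<^sup>2(\<real>\<^sup>d)\<close>
  of the classes that vanish almost everywhere outside \<open>\<Omega>\<close> (extension by zero); it carries the
  same inner product and norm.
\<close>

definition L2_on :: "'a::euclidean_space set \<Rightarrow> 'a L2 set" where
  "L2_on \<Omega> = {g. L2_vanishes_outside \<Omega> g}"

text \<open>
  An unbounded operator in the real Hilbert space \<open>H\<close> (a closed subspace of the ambient type) is a
  domain \<open>D\<close> with a function \<open>B\<close>, whose values outside \<open>D\<close> are irrelevant.
\<close>

definition linear_operator_in :: "'h::real_inner set \<Rightarrow> 'h set \<Rightarrow> ('h \<Rightarrow> 'h) \<Rightarrow> bool" where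
  "linear_operator_in H D B \<longleftrightarrow>
    subspace D \<and> D \<subseteq> H \<and> B ` D \<subseteq> H \<and>
    (\<forall>x\<in>D. \<forall>y\<in>D. B (x + y) = B x + B y) \<and> (\<forall>c. \<forall>x\<in>D. B (c *\<^sub>R x) = c *\<^sub>R B x)"

definition operator_graph :: "'h set \<Rightarrow> ('h \<Rightarrow> 'h) \<Rightarrow> ('h \<times> 'h) set" where
  "operator_graph D B = {(x, B x) | x. x \<in> D}"

text \<open>The graph of the adjoint of \<open>B\<close>, for densely defined \<open>B\<close>.\<close>

definition adjoint_graph :: "'h::real_inner set \<Rightarrow> 'h set \<Rightarrow> ('h \<Rightarrow> 'h) \<Rightarrow> ('h \<times> 'h) set" where
  "adjoint_graph H D B = {(y, z). y \<in> H \<and> z \<in> H \<and> (\<forall>x\<in>D. inner (B x) y = inner x z)}"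

definition self_adjoint_in :: "'h::real_inner set \<Rightarrow> 'h set \<Rightarrow> ('h \<Rightarrow> 'h) \<Rightarrow> bool" where
  "self_adjoint_in H D B \<longleftrightarrow>
    linear_operator_in H D B \<and> H \<subseteq> closure D \<and> adjoint_graph H D B = operator_graph D B"

definition positive_operator_on :: "'h::real_inner set \<Rightarrow> ('h \<Rightarrow> 'h) \<Rightarrow> bool" where
  "positive_operator_on D B \<longleftrightarrow> (\<forall>x\<in>D. 0 \<le> inner (B x) x)"

definition positive_type_kernel :: "(real \<Rightarrow> real) \<Rightarrow> bool" where
  "positive_type_kernel \<beta> \<longleftrightarrow>
    (\<forall>T>0. \<forall>\<phi>::real \<Rightarrow> real. continuous_on UNIV \<phi> \<longrightarrow>
      0 \<le> (LINT t:{0..T}|lebesgue. \<phi> t * (LINT s:{0..t}|lebesgue. \<beta> (t - s) * \<phi> s)))"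

text \<open>
  \<open>binf\<close> and \<open>b0\<close> below are \<open>\<beta>(\<infinity>)\<close> and \<open>\<beta>(0\<^sup>+)\<close>; the latter may be infinite. The values of \<open>\<beta>\<close> on
  \<open>(-\<infinity>, 0]\<close> are irrelevant.
\<close>

definition admissible_kernel :: "(real \<Rightarrow> real) \<Rightarrow> bool" where
  "admissible_kernel \<beta> \<longleftrightarrow>
    (\<forall>a b. 0 < a \<and> a < b \<longrightarrow> set_integrable lebesgue {a..b} \<beta>) \<and>
    set_integrable lebesgue {0<..<1} \<beta> \<and>
    positive_type_kernel \<beta> \<and>
    (\<exists>b0 binf. ((\<lambda>t. ereal (\<beta> t)) \<longlongrightarrow> b0) (at_right 0) \<and> (\<beta> \<longlongrightarrow> binf) at_top \<and>
      0 \<le> binf \<and> ereal binf < b0)"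

text \<open>
  Solutions are strong solutions: \<open>u\<close> is locally absolutely continuous on \<open>[0, \<infinity>)\<close>, i.e. a primitive
  of a locally Bochner integrable function \<open>u'\<close>; \<open>u(t)\<close> lies in both domains and the equation holds
  for almost every \<open>t > 0\<close>, and each \<open>\<^bold>B\<^sub>q u\<close> is locally Bochner integrable on \<open>[0, \<infinity>)\<close>, so that
  the convolutions converge absolutely for almost every \<open>t\<close>.
\<close>

definition volterra_solution ::
  "'h::{real_inner,banach,second_countable_topology} set \<Rightarrow> (nat \<Rightarrow> 'h set) \<Rightarrow> (nat \<Rightarrow> 'h \<Rightarrow> 'h) \<Rightarrow>
    (nat \<Rightarrow> real \<Rightarrow> real) \<Rightarrow> (real \<Rightarrow> 'h) \<Rightarrow> 'h \<Rightarrow> (real \<Rightarrow> 'h) \<Rightarrow> bool" where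
  "volterra_solution H D B \<beta> f u0 u \<longleftrightarrow>
    (\<forall>t\<ge>0. u t \<in> H) \<and> u 0 = u0 \<and>
    (\<forall>q\<in>{1,2}. (AE t in lebesgue. 0 < t \<longrightarrow> u t \<in> D q) \<and>
      (\<forall>T>0. set_integrable lebesgue {0..T} (\<lambda>s. B q (u s)))) \<and>
    (\<exists>u'. (\<forall>T>0. set_integrable lebesgue {0..T} u') \<and>
      (\<forall>t\<ge>0. u t = u 0 + (LINT s:{0..t}|lebesgue. u' s)) \<and>
      (AE t in lebesgue. 0 < t \<longrightarrow> (u has_vector_derivative u' t) (at t) \<and>
        u' t + (\<Sum>q\<in>{1,2}. LINT s:{0..t}|lebesgue. \<beta> q (t - s) *\<^sub>R B q (u s)) = f t))"

text \<open>The norm of \<open>L\<^sup>2(H\<^sup>0\<^sup>,\<^sup>s\<^sup>0)\<close> with values in \<open>[0, \<infinity>]\<close>; the conditional is the square root on \<open>[0, \<infinity>]\<close>.\<close>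

definition L2H_norm :: "real \<Rightarrow> (real \<Rightarrow> 'h::real_normed_vector) \<Rightarrow> ennreal" where
  "L2H_norm s0 w =
    (let I = \<integral>\<^sup>+t\<in>{0..}. ennreal ((norm (w t))\<^sup>2 * exp (- 2 * s0 * t)) \<partial>lebesgue
     in if I = \<infinity> then \<infinity> else ennreal (sqrt (enn2real I)))"

end

theory Submission
  imports Defs
begin

text \<open>
  Pair the equation with \<open>u\<close> and integrate. A positive operator admits a decomposition
  \<open>(B x, y) = \<Sum>\<^sub>k (x, z\<^sub>k) (y, z\<^sub>k)\<close> on its domain, so the memory term becomes a limit of sums of
  the quadratic forms of the scalar kernel \<open>\<beta>\<close> at the continuous functions \<open>t \<mapsto> (u(t), z\<^sub>k)\<close>, which
  are nonnegative. Hence \<open>\<parallel>u(t)\<parallel>\<^sup>2 \<le> \<parallel>u\<^sub>0\<parallel>\<^sup>2 + 2 \<integral>\<^sub>0\<^sup>t (f, u)\<close> for every \<open>t\<close>. Multiplying by \<open>exp (- 2 s\<^sub>0 t)\<close>,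
  integrating over \<open>[0, T]\<close> and applying Fubini turns the right-hand side into an integral of \<open>(f, u)\<close>
  against a weight between \<open>0\<close> and \<open>exp (- 2 s\<^sub>0 t) / s\<^sub>0\<close>; Young's inequality absorbs half of the
  left-hand side, and \<open>T \<rightarrow> \<infinity>\<close>.
\<close>

section \<open>Completed measures and integration by parts\<close>

text \<open>Needed for Fubini on products of \<open>lebesgue\<close>. A countable cover by sets of
  finite measure for \<open>M\<close> serves again, since these sets keep their measure in the
  completion.\<close>

lemma sigma_finite_completion:
  assumes "sigma_finite_measure M"
  shows "sigma_finite_measure (completion M)"
proof -
  interpret sigma_finite_measure M by fact
  obtain A where "countable A" "A \<subseteq> sets M" "\<Union>A = space M" "\<forall>a\<in>A. emeasure M a \<noteq> \<infinity>"
    using sigma_finite_countable by blast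
  then show ?thesis
    by unfold_locales (rule exI[of _ A], auto)
qed

interpretation lebesgue_pair: pair_sigma_finite "lebesgue :: real measure" "lebesgue :: real measure"
  unfolding pair_sigma_finite_def using sigma_finite_completion[OF sigma_finite_lborel] by blast

text \<open>Preimages under \<open>f\<close> and \<open>g\<close> differ by a null set, and the
  completion contains all subsets of null sets, so \<open>f\<close> inherits measurability. This is
  the bridge between \<open>lebesgue\<close>, in which the problem is stated, and
  \<open>lborel\<close>, in which the double integrals of the memory term are computed.\<close>

lemma
  fixes f g :: "'a \<Rightarrow> 'b::{banach,second_countable_topology}"
  assumes g: "g \<in> borel_measurable M" and ae: "AE x in M. f x = g x"
  shows measurable_completion_AE_eq: "f \<in> borel_measurable (completion M)"
    and integrable_completion_AE_eq: "integrable (completion M) f \<longleftrightarrow> integrable M g"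
    and integral_completion_AE_eq: "integral\<^sup>L (completion M) f = integral\<^sup>L M g"
proof -
  have g': "g \<in> borel_measurable (completion M)"
    using g by (rule measurable_completion)
  have ae': "AE x in completion M. f x = g x"
    using ae by (rule AE_completion)
  show f: "f \<in> borel_measurable (completion M)"
  proof (rule measurableI)
    fix A :: "'b set" assume "A \<in> sets borel"
    then have A: "g -` A \<inter> space (completion M) \<in> sets (completion M)"
      using g' by (rule measurable_sets[rotated])
    have "AE x in completion M. x \<in> g -` A \<inter> space (completion M) \<longleftrightarrow> x \<in> f -` A \<inter> space (completion M)"
      using ae' by eventually_elim auto
    from completion.in_sets_AE[OF this A] show "f -` A \<inter> space (completion M) \<in> sets (completion M)"
      by simp
  qed simp
  show "integrable (completion M) f \<longleftrightarrow> integrable M g"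
    using integrable_cong_AE[OF f g' ae'] integrable_completion[OF g] by simp
  show "integral\<^sup>L (completion M) f = integral\<^sup>L M g"
    using integral_cong_AE[OF f g' ae'] integral_completion[OF g] by simp
qed

lemma (in pair_sigma_finite) integrable_pair_mult:
  fixes a :: "'a \<Rightarrow> real" and b :: "'b \<Rightarrow> real"
  assumes [measurable]: "integrable M1 a" "integrable M2 b"
  shows "integrable (M1 \<Otimes>\<^sub>M M2) (\<lambda>(x, y). a x * b y)"
proof (rule Fubini_integrable)
  show "(\<lambda>(x, y). a x * b y) \<in> borel_measurable (M1 \<Otimes>\<^sub>M M2)"
    by measurable
qed (use assms in \<open>auto simp: abs_mult\<close>)

text \<open>Fubini for \<open>inner (p s) (q t)\<close> on the square with side
  \<open>{0..T}\<close>, split along the diagonal: each of the two triangles gives one of the two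
  integrals.\<close>

lemma set_integral_by_parts_inner:
  fixes p q :: "real \<Rightarrow> 'h::{real_inner,banach,second_countable_topology}"
  defines "P t \<equiv> LINT s:{0..t}|lebesgue. p s" and "Q t \<equiv> LINT s:{0..t}|lebesgue. q s"
  assumes p: "set_integrable lebesgue {0..T} p" and q: "set_integrable lebesgue {0..T} q"
  shows "set_integrable lebesgue {0..T} (\<lambda>t. inner (P t) (q t))"
    and "set_integrable lebesgue {0..T} (\<lambda>t. inner (p t) (Q t))"
    and "(LINT t:{0..T}|lebesgue. inner (P t) (q t)) + (LINT t:{0..T}|lebesgue. inner (p t) (Q t)) = inner (P T) (Q T)"
proof -
  define p' where "p' s = indicator {0..T} s *\<^sub>R p s" for s
  define q' where "q' s = indicator {0..T} s *\<^sub>R q s" for s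
  have p' [measurable]: "integrable lebesgue p'" and q' [measurable]: "integrable lebesgue q'"
    using p q by (simp_all add: set_integrable_def p'_def[abs_def] q'_def[abs_def])
  define E :: "(real \<times> real) set" where "E = {z. fst z \<le> snd z}"
  have E: "E \<in> sets (lebesgue \<Otimes>\<^sub>M lebesgue)"
  proof -
    have id: "(\<lambda>x. x) \<in> borel_measurable (lebesgue :: real measure)"
      by (rule measurable_completion) simp
    have "E = {z \<in> space (lebesgue \<Otimes>\<^sub>M lebesgue). fst z \<le> snd z}"
      by (auto simp: E_def space_pair_measure)
    also have "\<dots> \<in> sets (lebesgue \<Otimes>\<^sub>M lebesgue)"
    proof (rule borel_measurable_le)
      show "(fst :: real \<times> real \<Rightarrow> real) \<in> borel_measurable (lebesgue \<Otimes>\<^sub>M lebesgue)"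
        using id by measurable
      show "(snd :: real \<times> real \<Rightarrow> real) \<in> borel_measurable (lebesgue \<Otimes>\<^sub>M lebesgue)"
        using id by measurable
    qed
    finally show ?thesis .
  qed
  then have E': "- E \<in> sets (lebesgue \<Otimes>\<^sub>M lebesgue)"
    using sets.compl_sets[of E "lebesgue \<Otimes>\<^sub>M lebesgue"]
    by (simp add: space_pair_measure Compl_eq_Diff_UNIV)
  define F where "F = (\<lambda>(s, t). inner (p' s) (q' t))"
  have F: "integrable (lebesgue \<Otimes>\<^sub>M lebesgue) F"
  proof (rule Bochner_Integration.integrable_bound)
    show "integrable (lebesgue \<Otimes>\<^sub>M lebesgue) (\<lambda>(s, t). norm (p' s) * norm (q' t))"
      using p' q' by (intro lebesgue_pair.integrable_pair_mult) auto
    show "F \<in> borel_measurable (lebesgue \<Otimes>\<^sub>M lebesgue)" unfolding F_def by measurable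
  qed (auto simp: F_def Cauchy_Schwarz_ineq2)
  define G where "G s t = F (s, t) * indicator E (s, t)" for s t
  define G' where "G' s t = F (s, t) * indicator (- E) (s, t)" for s t
  have G: "integrable (lebesgue \<Otimes>\<^sub>M lebesgue) (case_prod G)"
    using integrable_real_mult_indicator[OF E F] by (rule Bochner_Integration.integrable_cong[THEN iffD1, rotated 2])
      (auto simp: G_def)
  have G': "integrable (lebesgue \<Otimes>\<^sub>M lebesgue) (case_prod G')"
    using integrable_real_mult_indicator[OF E' F] by (rule Bochner_Integration.integrable_cong[THEN iffD1, rotated 2])
      (auto simp: G'_def)
  have P: "(LINT s|lebesgue. G s t) = indicator {0..T} t *\<^sub>R inner (P t) (q t)" for t
  proof (cases "t \<in> {0..T}")
    case True
    have "integrable lebesgue (\<lambda>s. indicator {0..t} s *\<^sub>R p s)"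
      using set_integrable_subset[OF p, of "{0..t}"] True by (simp add: set_integrable_def)
    then have "inner (P t) (q t) = (LINT s|lebesgue. inner (indicator {0..t} s *\<^sub>R p s) (q t))"
      by (simp add: P_def set_lebesgue_integral_def del: inner_scaleR_left)
    also have "\<dots> = (LINT s|lebesgue. G s t)"
      using True by (intro Bochner_Integration.integral_cong) (auto simp: G_def F_def p'_def q'_def E_def indicator_def)
    finally show ?thesis using True by simp
  qed (simp add: G_def F_def q'_def)
  have Q: "(LINT t|lebesgue. G' s t) = indicator {0..T} s *\<^sub>R inner (p s) (Q s)" for s
  proof (cases "s \<in> {0..T}")
    case True
    have int: "integrable lebesgue (\<lambda>t. indicator {0..s} t *\<^sub>R q t)"
      using set_integrable_subset[OF q, of "{0..s}"] True by (simp add: set_integrable_def)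
    then have "inner (p s) (Q s) = (LINT t|lebesgue. inner (p s) (indicator {0..s} t *\<^sub>R q t))"
      by (simp add: Q_def set_lebesgue_integral_def del: inner_scaleR_right)
    also have "\<dots> = (LINT t|lebesgue. G' s t)"
    proof (rule integral_cong_AE)
      show "(\<lambda>t. inner (p s) (indicator {0..s} t *\<^sub>R q t)) \<in> borel_measurable lebesgue"
        using int by measurable
      show "G' s \<in> borel_measurable lebesgue"
        using measurable_compose[OF measurable_Pair1' borel_measurable_integrable[OF G'], of s] by simp
      \<comment> \<open>The set \<open>- E\<close> omits the diagonal, while \<open>Q s\<close>
        integrates over the closed interval; the integrands can differ at \<open>t = s\<close>
        only.\<close>
      have "AE t in lebesgue. t \<noteq> s"
        by (rule AE_I'[of "{s}"]) auto
      then show "AE t in lebesgue. inner (p s) (indicator {0..s} t *\<^sub>R q t) = G' s t"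
        by eventually_elim (use True in \<open>auto simp: G'_def F_def p'_def q'_def E_def indicator_def\<close>)
    qed
    finally show ?thesis using True by simp
  qed (simp add: G'_def F_def p'_def)
  show "set_integrable lebesgue {0..T} (\<lambda>t. inner (P t) (q t))"
    using lebesgue_pair.integrable_snd[OF G] by (simp add: P set_integrable_def)
  show "set_integrable lebesgue {0..T} (\<lambda>t. inner (p t) (Q t))"
    using lebesgue_pair.integrable_fst[OF G'] by (simp add: Q set_integrable_def)
  have "inner (P T) (Q T) = (LINT s|lebesgue. inner (p' s) (Q T))"
    using p' by (simp add: P_def set_lebesgue_integral_def p'_def[abs_def] del: inner_scaleR_left)
  also have "\<dots> = (LINT s|lebesgue. LINT t|lebesgue. F (s, t))"
    using q' by (simp add: F_def Q_def set_lebesgue_integral_def q'_def[abs_def] del: inner_scaleR_right)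
  also have "\<dots> = integral\<^sup>L (lebesgue \<Otimes>\<^sub>M lebesgue) F"
    by (rule lebesgue_pair.integral_fst'[OF F])
  also have "\<dots> = integral\<^sup>L (lebesgue \<Otimes>\<^sub>M lebesgue) (\<lambda>z. case_prod G z + case_prod G' z)"
    by (intro Bochner_Integration.integral_cong) (auto simp: G_def G'_def indicator_def)
  also have "\<dots> = integral\<^sup>L (lebesgue \<Otimes>\<^sub>M lebesgue) (case_prod G) + integral\<^sup>L (lebesgue \<Otimes>\<^sub>M lebesgue) (case_prod G')"
    using G G' by simp
  also have "\<dots> = (LINT t:{0..T}|lebesgue. inner (P t) (q t)) + (LINT t:{0..T}|lebesgue. inner (p t) (Q t))"
    using lebesgue_pair.integral_snd[OF G] lebesgue_pair.integral_fst[OF G']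
    by (simp add: P Q set_lebesgue_integral_def)
  finally show "(LINT t:{0..T}|lebesgue. inner (P t) (q t)) + (LINT t:{0..T}|lebesgue. inner (p t) (Q t)) = inner (P T) (Q T)"
    by simp
qed

text \<open>Dominated convergence along a convergent sequence: all its terms lie below one
  \<open>C\<close>, and the indicators of \<open>{a..X n}\<close> become stationary at every point
  other than the limit \<open>x\<close>.\<close>

lemma continuous_on_indefinite_set_integral:
  fixes p :: "real \<Rightarrow> 'h::{banach,second_countable_topology}"
  assumes p: "\<And>T. 0 < T \<Longrightarrow> set_integrable lebesgue {a..T} p"
  shows "continuous_on {a..} (\<lambda>t. LINT s:{a..t}|lebesgue. p s)"
  unfolding continuous_on_sequentially
proof safe
  fix X x assume X: "\<forall>n. X n \<in> {a..}" "X \<longlonglongrightarrow> x" and "a \<le> x"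
  then obtain C where C: "0 < C" "\<And>n. \<bar>X n\<bar> \<le> C"
    using convergent_imp_Bseq[of X] by (auto simp: convergent_def Bseq_def)
  have pC: "integrable lebesgue (\<lambda>s. indicator {a..C} s *\<^sub>R p s)"
    using p[OF C(1)] by (simp add: set_integrable_def)
  have "x \<le> C" using X(2) C(2) by (intro LIMSEQ_le_const2[of X]) (auto simp: abs_le_iff)
  show "((\<lambda>t. LINT s:{a..t}|lebesgue. p s) \<circ> X) \<longlonglongrightarrow> (LINT s:{a..x}|lebesgue. p s)"
    unfolding o_def set_lebesgue_integral_def
  proof (rule integral_dominated_convergence)
    show "integrable lebesgue (\<lambda>s. norm (indicator {a..C} s *\<^sub>R p s))"
      using pC by (rule integrable_norm)
    have meas: "(\<lambda>s. indicator {a..y} s *\<^sub>R p s) \<in> borel_measurable lebesgue" if "y \<le> C" for y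
      using set_integrable_subset[OF p[OF C(1)], of "{a..y}"] that by (auto simp: set_integrable_def)
    show "(\<lambda>s. indicator {a..x} s *\<^sub>R p s) \<in> borel_measurable lebesgue"
      using \<open>x \<le> C\<close> by (rule meas)
    show "(\<lambda>s. indicator {a..X n} s *\<^sub>R p s) \<in> borel_measurable lebesgue" for n
      using C(2)[of n] by (intro meas) linarith
    show "AE s in lebesgue. norm (indicator {a..X n} s *\<^sub>R p s) \<le> norm (indicator {a..C} s *\<^sub>R p s)" for n
      using C(2)[of n] by (auto simp: indicator_def)
    have "AE s in lebesgue. s \<noteq> x"
      by (rule AE_I'[of "{x}"]) auto
    then show "AE s in lebesgue. (\<lambda>n. indicator {a..X n} s *\<^sub>R p s) \<longlonglongrightarrow> indicator {a..x} s *\<^sub>R p s"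
    proof eventually_elim
      case (elim s)
      have "\<forall>\<^sub>F n in sequentially. (X n < s) = (x < s)"
      proof (cases "x < s")
        case True
        then show ?thesis using order_tendstoD(2)[OF X(2)] by (auto elim: eventually_mono)
      next
        case False
        then have "s < x" using elim by simp
        then show ?thesis using order_tendstoD(1)[OF X(2), of s] by (auto elim: eventually_mono)
      qed
      then have "\<forall>\<^sub>F n in sequentially. indicator {a..X n} s *\<^sub>R p s = indicator {a..x} s *\<^sub>R p s"
        by eventually_elim (auto simp: indicator_def)
      then show ?case by (rule tendsto_eventually)
    qed
  qed
qed

section \<open>Factorization of positive symmetric operators\<close>

text \<open>Choose a point of \<open>S\<close> in every basic open set that meets \<open>S\<close>.
  The set \<open>S\<close> will be the graph of an operator.\<close>

lemma ex_countable_dense_subset: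
  fixes S :: "'a::second_countable_topology set"
  obtains T where "countable T" "T \<subseteq> S" "S \<subseteq> closure T"
proof -
  obtain \<B> :: "'a set set" where \<B>: "countable \<B>" "topological_basis \<B>"
    using ex_countable_basis by blast
  define T where "T = (\<lambda>U. SOME x. x \<in> U \<inter> S) ` {U \<in> \<B>. U \<inter> S \<noteq> {}}"
  have pick: "(SOME x. x \<in> U \<inter> S) \<in> U \<inter> S" if "U \<inter> S \<noteq> {}" for U
    using that by (metis ex_in_conv someI_ex)
  show thesis
  proof
    show "countable T" using \<B>(1) by (simp add: T_def)
    show "T \<subseteq> S" using pick by (auto simp: T_def)
    show "S \<subseteq> closure T"
    proof
      fix x assume "x \<in> S"
      show "x \<in> closure T"
        unfolding closure_iff_nhds_not_empty
      proof (intro allI impI)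
        fix A V assume "V \<subseteq> A" "open V" "x \<in> V"
        then obtain U where U: "U \<in> \<B>" "x \<in> U" "U \<subseteq> V"
          using \<B>(2) by (meson topological_basisE)
        with \<open>x \<in> S\<close> have "(SOME x. x \<in> U \<inter> S) \<in> T \<inter> U"
          using pick[of U] by (auto simp: T_def)
        with U \<open>V \<subseteq> A\<close> show "T \<inter> A \<noteq> {}" by blast
      qed
    qed
  qed
qed

text \<open>This class of operators on a fixed domain is closed under the rank-one modification
  \<open>downdate\<close>, so the elimination below can be iterated inside it.\<close>

locale positive_symmetric =
  fixes D :: "'h::real_inner set" and B :: "'h \<Rightarrow> 'h"
  assumes subspace: "subspace D"
    and add: "x \<in> D \<Longrightarrow> y \<in> D \<Longrightarrow> B (x + y) = B x + B y"
    and scale: "x \<in> D \<Longrightarrow> B (c *\<^sub>R x) = c *\<^sub>R B x"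
    and symmetric: "x \<in> D \<Longrightarrow> y \<in> D \<Longrightarrow> inner (B x) y = inner x (B y)"
    and positive: "x \<in> D \<Longrightarrow> 0 \<le> inner (B x) x"
begin

lemma diff:
  assumes "x \<in> D" "y \<in> D"
  shows "B (x - y) = B x - B y"
  using add[OF assms(1) subspace_scale[OF subspace assms(2), of "-1"]] scale[OF assms(2), of "-1"] by simp

lemma diff_form:
  assumes "x \<in> D" "y \<in> D"
  shows "inner (B (x - y)) (x - y) = inner (B x) x - 2 * inner x (B y) + inner (B y) y"
proof -
  have "inner (B y) x = inner x (B y)" by (simp add: inner_commute)
  then show ?thesis
    using symmetric[OF assms] assms by (simp add: diff inner_diff_left inner_diff_right)
qed

text \<open>The quadratic polynomial \<open>r \<mapsto> inner (B (x - r *\<^sub>R y)) (x - r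
  *\<^sub>R y)\<close> is nonnegative. The form may be degenerate, so a vanishing leading
  coefficient is a separate case.\<close>

lemma Cauchy_Schwarz:
  assumes x: "x \<in> D" and y: "y \<in> D"
  shows "(inner x (B y))\<^sup>2 \<le> inner (B x) x * inner (B y) y"
proof -
  define a b c where "a = inner (B y) y" and "b = inner x (B y)" and "c = inner (B x) x"
  have quad: "0 \<le> c - 2 * r * b + r\<^sup>2 * a" for r
  proof -
    have ry: "r *\<^sub>R y \<in> D" using y subspace by (simp add: subspace_scale)
    then have "0 \<le> inner (B (x - r *\<^sub>R y)) (x - r *\<^sub>R y)"
      using x subspace by (simp add: positive subspace_diff)
    then show ?thesis
      unfolding diff_form[OF x ry] scale[OF y] by (simp add: a_def b_def c_def power2_eq_square mult.assoc)
  qed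
  have "b\<^sup>2 \<le> c * a"
  proof (cases "a = 0")
    case True
    have "b = 0"
    proof (rule ccontr)
      assume "b \<noteq> 0"
      \<comment> \<open>At this \<open>r\<close> the polynomial, which is affine when
        \<open>a = 0\<close>, takes the value -1.\<close>
      then have "2 * ((c + 1) / (2 * b)) * b = c + 1" by (simp add: field_simps)
      then show False using quad[of "(c + 1) / (2 * b)"] True by simp
    qed
    then show ?thesis using True by simp
  next
    case False
    then have "0 < a" using positive[OF y] by (simp add: a_def)
    \<comment> \<open>The minimum of the polynomial is at \<open>r = b / a\<close>.\<close>
    have "2 * (b / a) * b = 2 * (b\<^sup>2 / a)" "(b / a)\<^sup>2 * a = b\<^sup>2 / a"
      using False by (simp_all add: power2_eq_square field_simps)
    then have "b\<^sup>2 / a \<le> c"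
      using quad[of "b / a"] by linarith
    then show ?thesis using \<open>0 < a\<close> by (simp add: field_simps)
  qed
  then show ?thesis by (simp add: a_def b_def c_def)
qed

end

text \<open>One step of symmetric Gaussian elimination with pivot \<open>g\<close>, that is, a Schur
  complement. If the pivot value \<open>inner (R g) g\<close> is 0, division by zero makes the
  correction vanish and \<open>R\<close> is left unchanged.\<close>

definition downdate :: "('h::real_inner \<Rightarrow> 'h) \<Rightarrow> 'h \<Rightarrow> 'h \<Rightarrow> 'h" where
  "downdate R g x = R x - (inner x (R g) / inner (R g) g) *\<^sub>R R g"

lemma inner_downdate:
  "inner (downdate R g x) y = inner (R x) y - inner x (R g) * inner y (R g) / inner (R g) g"
  by (simp add: downdate_def inner_diff_left inner_commute[of "R g" y])

text \<open>Nonnegativity of the reduced form is the Cauchy-Schwarz inequality of the form of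
  \<open>R\<close>, applied to \<open>x\<close> and \<open>g\<close>.\<close>

lemma positive_symmetric_downdate:
  assumes "positive_symmetric D R" "g \<in> D"
  shows "positive_symmetric D (downdate R g)"
proof -
  interpret positive_symmetric D R by fact
  show ?thesis
  proof
    show "subspace D" by (fact subspace)
    fix x y c assume x: "x \<in> D"
    show "downdate R g (c *\<^sub>R x) = c *\<^sub>R downdate R g x"
      using x by (simp add: downdate_def scale scaleR_diff_right)
    show "0 \<le> inner (downdate R g x) x"
    proof (cases "inner (R g) g = 0")
      case True
      then show ?thesis using positive[OF x] by (simp add: inner_downdate)
    next
      case False
      then have "0 < inner (R g) g" using positive[OF assms(2)] by simp
      then show ?thesis
        using Cauchy_Schwarz[OF x assms(2)] by (simp add: inner_downdate field_simps power2_eq_square)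
    qed
    assume y: "y \<in> D"
    show "downdate R g (x + y) = downdate R g x + downdate R g y"
      using x y by (simp add: downdate_def add inner_add_left add_divide_distrib scaleR_add_left)
    show "inner (downdate R g x) y = inner x (downdate R g y)"
      unfolding inner_commute[of x "downdate R g y"] inner_downdate
      using symmetric[OF x y] by (simp add: inner_commute[of "R y"] mult.commute)
  qed
qed

text \<open>
  This replaces the square root of \<open>B\<close>: a Cholesky factorization along a sequence that is dense
  for the graph norm.
\<close>

theorem positive_symmetric_form_sums:
  fixes D :: "'h::{real_inner,second_countable_topology} set"
  assumes "positive_symmetric D B"
  obtains z :: "nat \<Rightarrow> 'h"
  where "\<And>x y. x \<in> D \<Longrightarrow> y \<in> D \<Longrightarrow> (\<lambda>k. inner x (z k) * inner y (z k)) sums inner (B x) y"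
proof -
  interpret positive_symmetric D B by fact
  \<comment> \<open>Density in the graph approximates \<open>x\<close> and \<open>B x\<close>
    simultaneously; \<open>B\<close> may be unbounded.\<close>
  obtain T :: "('h \<times> 'h) set" where T: "countable T" "T \<subseteq> (\<lambda>x. (x, B x)) ` D" "(\<lambda>x. (x, B x)) ` D \<subseteq> closure T"
    using ex_countable_dense_subset by blast
  have "T \<noteq> {}" using T(3) subspace_0[OF subspace] by auto
  define g where "g k = fst (from_nat_into T k)" for k
  have T_eq: "T = range (\<lambda>k. (g k, B (g k)))"
  proof -
    have "from_nat_into T k = (g k, B (g k))" for k
      using from_nat_into[OF \<open>T \<noteq> {}\<close>, of k] T(2) by (auto simp: g_def)
    then show ?thesis using range_from_nat_into[OF \<open>T \<noteq> {}\<close> T(1)] by simp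
  qed
  have gD: "g k \<in> D" for k using T(2) by (auto simp: T_eq)
  \<comment> \<open>\<open>R k\<close> is the residual after elimination with the pivots
    \<open>g 0\<close> up to \<open>g (k - 1)\<close>.\<close>
  define R where "R = rec_nat B (\<lambda>k S. downdate S (g k))"
  have R0: "R 0 = B" and RS: "R (Suc k) = downdate (R k) (g k)" for k by (simp_all add: R_def)
  have psR: "positive_symmetric D (R k)" for k
    by (induction k) (use assms gD in \<open>auto simp: R0 RS intro: positive_symmetric_downdate\<close>)
  note R_nonneg = positive_symmetric.positive[OF psR]
  \<comment> \<open>The normalized Cholesky column. A zero pivot value gives \<open>z k = 0\<close>,
    in agreement with \<open>R (Suc k) = R k\<close>.\<close>
  define z where "z k = (1 / sqrt (inner (R k (g k)) (g k))) *\<^sub>R R k (g k)" for k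
  have zz: "inner x (z k) * inner x (z k) = inner (R k x) x - inner (R (Suc k) x) x" for x k
    using R_nonneg[OF gD, of k k] by (simp add: RS inner_downdate z_def flip: real_sqrt_mult)
  have decr: "inner (R (n + m) x) x \<le> inner (R n x) x" for n m x
  proof (induction m)
    case (Suc m)
    have "0 \<le> inner x (z (n + m)) * inner x (z (n + m))" by simp
    with Suc show ?case unfolding zz by simp
  qed simp
  \<comment> \<open>Step \<open>i\<close> annihilates the form at its pivot, and later steps only
    decrease a form that stays nonnegative.\<close>
  have R_g: "inner (R n (g i)) (g i) = 0" if "i < n" for i n
  proof -
    obtain m where n: "n = Suc i + m" using less_imp_Suc_add[OF \<open>i < n\<close>] by auto
    have "inner (R (Suc i) (g i)) (g i) = 0"
      by (simp add: RS inner_downdate inner_commute[of "g i" "R i (g i)"])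
    then show ?thesis using decr[of "Suc i" m "g i"] R_nonneg[OF gD, of n i] by (simp add: n)
  qed
  \<comment> \<open>By Cauchy-Schwarz, a used pivot \<open>g i\<close> lies in the radical of the
    residual form. Subtracting it from \<open>x\<close> does not change the residual, which is then
    compared with the initial form.\<close>
  have R_le: "inner (R n x) x \<le> inner (B (x - g i)) (x - g i)" if "i < n" "x \<in> D" for i n x
  proof -
    interpret R: positive_symmetric D "R n" by (rule psR)
    have "(inner x (R n (g i)))\<^sup>2 \<le> 0"
      using R.Cauchy_Schwarz[OF that(2) gD, of i] R_g[OF that(1)] by simp
    then have "inner (R n x) x = inner (R n (x - g i)) (x - g i)"
      using that gD R_g[OF that(1)] by (simp add: R.diff_form)
    also have "\<dots> \<le> inner (B (x - g i)) (x - g i)"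
      using decr[of 0 n] by (simp add: R0)
    finally show ?thesis .
  qed
  have lim: "(\<lambda>n. inner (R n x) x) \<longlonglongrightarrow> 0" if x: "x \<in> D" for x
  proof (rule LIMSEQ_I)
    fix e :: real assume "0 < e"
    \<comment> \<open>The form at \<open>x - g i\<close> is bounded by a product of two distances;
      the cap 1 ensures \<open>d * d \<le> e\<close>.\<close>
    define d where "d = min 1 e"
    have d: "0 < d" "d \<le> 1" "d \<le> e" using \<open>0 < e\<close> by (auto simp: d_def)
    have "(x, B x) \<in> closure T" using T(3) x by blast
    then obtain i where i: "dist (g i, B (g i)) (x, B x) < d"
      using d(1) unfolding closure_approachable T_eq by auto
    have "norm (x - g i) < d" "norm (B x - B (g i)) < d"
      using i dist_fst_le[of "(g i, B (g i))" "(x, B x)"] dist_snd_le[of "(g i, B (g i))" "(x, B x)"]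
      by (auto simp: dist_norm norm_minus_commute)
    then have "norm (B (x - g i)) * norm (x - g i) < d * d"
      by (simp add: diff[OF x gD] mult_strict_mono')
    also have "d * d \<le> e" using d mult_mono[of d 1 d e] by simp
    finally have "inner (B (x - g i)) (x - g i) < e"
      using norm_cauchy_schwarz[of "B (x - g i)" "x - g i"] by linarith
    then have "\<bar>inner (R n x) x\<bar> < e" if "n \<ge> Suc i" for n
      using R_le[of i n x] R_nonneg[OF x, of n] that x by simp
    then show "\<exists>N. \<forall>n\<ge>N. norm (inner (R n x) x - 0) < e"
      unfolding real_norm_def diff_zero by blast
  qed
  have sq: "(\<lambda>k. inner x (z k) * inner x (z k)) sums inner (B x) x" if "x \<in> D" for x
    using telescope_sums'[OF lim[OF that]] by (simp add: zz R0)
  show thesis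
  proof
    fix x y assume x: "x \<in> D" and y: "y \<in> D"
    have xy: "x + y \<in> D" "x - y \<in> D"
      using x y subspace by (simp_all add: subspace_add subspace_diff)
    have yx: "inner (B y) x = inner (B x) y"
      unfolding symmetric[OF x y] by (rule inner_commute)
    \<comment> \<open>Polarization reduces the mixed form to the diagonal one.\<close>
    have eq: "inner (B x) y = (inner (B (x + y)) (x + y) - inner (B (x - y)) (x - y)) / 4"
      using yx by (simp add: diff[OF x y] add[OF x y] inner_add_left inner_add_right inner_diff_left inner_diff_right)
    show "(\<lambda>k. inner x (z k) * inner y (z k)) sums inner (B x) y"
      unfolding eq by (rule sums_cong[THEN iffD1, OF _ sums_divide[OF sums_diff[OF sq[OF xy(1)] sq[OF xy(2)]], of 4]])
        (simp add: inner_add_left inner_diff_left algebra_simps)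
  qed
qed

section \<open>Positivity of the memory term\<close>

lemma AE_lborel_null_set:
  assumes "AE x in lborel. P x"
  shows "\<exists>N \<in> null_sets lborel. \<forall>x. x \<notin> N \<longrightarrow> P x"
  using assms unfolding eventually_ae_filter by auto

lemma AE_lborel_reflect:
  fixes P :: "real \<Rightarrow> bool"
  assumes "AE x in lborel. P x"
  shows "AE s in lborel. P (t - s)"
proof -
  obtain N where N: "\<forall>x. x \<notin> N \<longrightarrow> P x" "N \<in> null_sets lborel"
    using AE_lborel_null_set[OF assms] by blast
  have [measurable]: "N \<in> sets borel" using N(2) by auto
  have "AE s in lborel. t + (- 1) * s \<notin> N"
    by (rule AE_borel_affine[of "-1" "\<lambda>x. x \<notin> N"]) (use N(2) in \<open>auto dest: AE_not_in\<close>)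
  then show ?thesis
    by eventually_elim (use N(1) in auto)
qed

lemma integrable_lborel_reflect:
  fixes a :: "real \<Rightarrow> real"
  assumes "integrable lborel a"
  shows "integrable lborel (\<lambda>s. a (t - s))"
    and "(LINT s|lborel. a (t - s)) = integral\<^sup>L lborel a"
  using lborel_integrable_real_affine[OF assms, of "-1" t] lborel_integral_real_affine[of "-1" a t] by simp_all

text \<open>After a reflection, the integral of the absolute value over \<open>s\<close> is
  \<open>\<bar>b t\<bar>\<close> times the L1 norm of \<open>a\<close>.\<close>

lemma integrable_shifted_mult:
  fixes a b :: "real \<Rightarrow> real"
  assumes [measurable]: "integrable lborel a" "integrable lborel b"
  shows "integrable (lborel \<Otimes>\<^sub>M lborel) (\<lambda>(t, s). a (t - s) * b t)"
proof (rule lborel_pair.Fubini_integrable)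
  show "(\<lambda>(t, s). a (t - s) * b t) \<in> borel_measurable (lborel \<Otimes>\<^sub>M lborel)" by measurable
  have a: "integrable lborel (\<lambda>s. \<bar>a s\<bar>)" using assms by simp
  show "integrable lborel (\<lambda>t. LINT s|lborel. norm (case (t, s) of (t, s) \<Rightarrow> a (t - s) * b t))"
    using assms by (simp add: abs_mult integrable_lborel_reflect(2)[OF a])
  show "AE t in lborel. integrable lborel (\<lambda>s. case (t, s) of (t, s) \<Rightarrow> a (t - s) * b t)"
    using assms by (simp add: integrable_lborel_reflect)
qed

text \<open>The previous lemma for the reflected \<open>a\<close>, with the two variables
  exchanged.\<close>

lemma integrable_convolution_pair:
  fixes a b :: "real \<Rightarrow> real"
  assumes "integrable lborel a" "integrable lborel b"
  shows "integrable (lborel \<Otimes>\<^sub>M lborel) (\<lambda>(t, s). a (t - s) * b s)"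
proof -
  have "integrable lborel (\<lambda>x. a (- x))"
    using integrable_lborel_reflect(1)[OF assms(1), of 0] by simp
  from lborel_pair.integrable_product_swap[OF integrable_shifted_mult[OF this assms(2)]]
  show ?thesis by simp
qed

lemma ex_borel_integrable_version:
  fixes f :: "'a::euclidean_space \<Rightarrow> real"
  assumes "integrable lebesgue f"
  obtains g where "integrable lborel g" "AE x in lborel. f x = g x"
proof -
  obtain g where g: "g \<in> borel_measurable lborel" "AE x in lborel. f x = g x"
    using completion_ex_borel_measurable_real[of f lborel] assms by auto
  then show thesis
    using that integrable_completion_AE_eq[OF g] assms by blast
qed

section \<open>Positivity for a single operator and kernel on a finite interval\<close>

locale volterra_positive = positive_symmetric D B
  for D :: "'h::{real_inner,banach,second_countable_topology} set" and B +
  fixes \<beta> :: "real \<Rightarrow> real" and u :: "real \<Rightarrow> 'h" and T :: real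
  assumes T: "0 < T"
    and \<beta>: "set_integrable lebesgue {0<..T} \<beta>" "positive_type_kernel \<beta>"
    and cont: "continuous_on {0..} u"
    and uD: "AE t in lebesgue. 0 < t \<longrightarrow> u t \<in> D"
    and Bu: "set_integrable lebesgue {0..T} (\<lambda>s. B (u s))"
begin

abbreviation triangle :: "(real \<times> real) set" where
  "triangle \<equiv> {(t, s). 0 \<le> s \<and> s \<le> t \<and> t \<le> T}"

lemma triangle_measurable [measurable]: "triangle \<in> sets (borel \<Otimes>\<^sub>M borel)"
proof -
  have "triangle = {z \<in> space (borel \<Otimes>\<^sub>M borel). 0 \<le> snd z \<and> snd z \<le> fst z \<and> fst z \<le> T}"
    by (auto simp: space_pair_measure)
  also have "\<dots> \<in> sets (borel \<Otimes>\<^sub>M borel)" by measurable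
  finally show ?thesis .
qed

text \<open>Recasts the iterated \<open>lebesgue\<close> integral of the positivity condition as an
  integral over the triangle for \<open>lborel\<close>, a form in which sums over test functions can
  be passed to the limit by dominated convergence.\<close>

lemma positive_type_double_integral:
  assumes b: "integrable lborel b" "AE x in lborel. indicator {0<..T} x * \<beta> x = b x"
    and \<psi>: "continuous_on UNIV \<psi>"
  defines "S \<equiv> \<lambda>(t, s). indicator triangle (t, s) * (b (t - s) * (\<psi> s * \<psi> t))"
  shows "integrable (lborel \<Otimes>\<^sub>M lborel) S" and "0 \<le> integral\<^sup>L (lborel \<Otimes>\<^sub>M lborel) S"
proof -
  have [measurable]: "\<psi> \<in> borel_measurable borel" "b \<in> borel_measurable borel"
    using \<psi> b(1) by (auto intro: borel_measurable_continuous_onI)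
  have "bounded (\<psi> ` {0..T})"
    using \<psi> by (intro compact_imp_bounded compact_continuous_image) (auto intro: continuous_on_subset)
  then obtain M where "\<forall>t\<in>{0..T}. \<bar>\<psi> t\<bar> \<le> M"
    unfolding bounded_iff by auto
  then have M: "\<bar>\<psi> t\<bar> \<le> M" if "0 \<le> t" "t \<le> T" for t
    using that by simp
  have "0 \<le> M" using M[of 0] T by simp
  show int: "integrable (lborel \<Otimes>\<^sub>M lborel) S"
  proof (rule Bochner_Integration.integrable_bound)
    show "integrable (lborel \<Otimes>\<^sub>M lborel) (\<lambda>(t, s). b (t - s) * (indicator {0..T} s * (M * M)))"
      by (intro integrable_convolution_pair b(1) integrable_mult_left integrable_real_indicator)
        (use T in simp_all)
    show "S \<in> borel_measurable (lborel \<Otimes>\<^sub>M lborel)" unfolding S_def by measurable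
    have "norm (S (t, s)) \<le> norm (b (t - s) * (indicator {0..T} s * (M * M)))" for t s
    proof (cases "(t, s) \<in> triangle")
      case True
      then have "\<bar>\<psi> s\<bar> * \<bar>\<psi> t\<bar> \<le> M * M"
        using \<open>0 \<le> M\<close> by (intro mult_mono M) auto
      then show ?thesis
        using True \<open>0 \<le> M\<close> by (simp add: S_def abs_mult mult_left_mono)
    qed (simp add: S_def)
    then show "AE z in lborel \<Otimes>\<^sub>M lborel. norm (S z) \<le> norm (case z of (t, s) \<Rightarrow> b (t - s) * (indicator {0..T} s * (M * M)))"
      by (intro AE_I2) (simp add: split_paired_all)
  qed
  have inner_int: "(LINT s:{0..t}|lebesgue. \<beta> (t - s) * \<psi> s) = (LINT s|lborel. indicator {0..t} s * (b (t - s) * \<psi> s))"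
    if "t \<le> T" for t
    unfolding set_lebesgue_integral_def
  proof (rule integral_completion_AE_eq)
    show "(\<lambda>s. indicator {0..t} s * (b (t - s) * \<psi> s)) \<in> borel_measurable lborel" by measurable
    \<comment> \<open>\<open>b\<close> represents \<open>\<beta>\<close> on \<open>{0<..T}\<close>
      only, so the point \<open>s = t\<close>, where the argument is 0, is removed.\<close>
    have "AE s in lborel. s \<noteq> t" by (rule AE_lborel_singleton)
    with AE_lborel_reflect[OF b(2), of t]
    show "AE s in lborel. indicator {0..t} s *\<^sub>R (\<beta> (t - s) * \<psi> s) = indicator {0..t} s * (b (t - s) * \<psi> s)"
      by eventually_elim (use that in \<open>auto simp: indicator_def split: if_splits\<close>)
  qed
  have eq: "indicator {0..T} t *\<^sub>R (\<psi> t * (LINT s:{0..t}|lebesgue. \<beta> (t - s) * \<psi> s)) = (LINT s|lborel. S (t, s))" for t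
  proof (cases "t \<in> {0..T}")
    case True
    then have "\<psi> t * (LINT s:{0..t}|lebesgue. \<beta> (t - s) * \<psi> s)
        = (LINT s|lborel. \<psi> t * (indicator {0..t} s * (b (t - s) * \<psi> s)))"
      by (simp add: inner_int)
    also have "\<dots> = (LINT s|lborel. S (t, s))"
      using True by (intro Bochner_Integration.integral_cong) (auto simp: S_def indicator_def)
    finally show ?thesis using True by simp
  next
    case False
    then have "S (t, s) = 0" for s by (auto simp: S_def indicator_def)
    with False show ?thesis by simp
  qed
  have "0 \<le> (LINT t:{0..T}|lebesgue. \<psi> t * (LINT s:{0..t}|lebesgue. \<beta> (t - s) * \<psi> s))"
    using \<beta>(2) T \<psi> unfolding positive_type_kernel_def by blast
  also have "\<dots> = (LINT t|lborel. LINT s|lborel. S (t, s))"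
    unfolding set_lebesgue_integral_def[of lebesgue "{0..T}"] eq
    using lborel_pair.integrable_fst'[OF int] by (intro integral_completion) auto
  also have "\<dots> = integral\<^sup>L (lborel \<Otimes>\<^sub>M lborel) S"
    by (rule lborel_pair.integral_fst'[OF int])
  finally show "0 \<le> integral\<^sup>L (lborel \<Otimes>\<^sub>M lborel) S" .
qed

abbreviation conv :: "real \<Rightarrow> 'h" where
  "conv t \<equiv> LINT s:{0..t}|lebesgue. \<beta> (t - s) *\<^sub>R B (u s)"

text \<open>
  Lebesgue measurable functions are replaced by Borel versions \<open>b\<close> and \<open>c\<close>, since \<open>(t, s) \<mapsto> \<beta> (t - s)\<close>
  need not be measurable for the product of two copies of \<open>lebesgue\<close>.
\<close>

theorem convolution_inner_nonneg:
  shows "set_integrable lebesgue {0..T} (\<lambda>t. inner (conv t) (u t))" (is ?int)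
    and "0 \<le> (LINT t:{0..T}|lebesgue. inner (conv t) (u t))" (is ?nonneg)
proof -
  obtain b where b: "integrable lborel b" "AE x in lborel. indicator {0<..T} x * \<beta> x = b x"
    using ex_borel_integrable_version[of "\<lambda>x. indicator {0<..T} x * \<beta> x"] \<beta>(1)
    by (auto simp: set_integrable_def)
  \<comment> \<open>The norm of \<open>B (u x)\<close> is all that needs a Borel version: it enters
    the majorant.\<close>
  obtain c where c: "integrable lborel c" "AE x in lborel. norm (indicator {0..T} x *\<^sub>R B (u x)) = c x"
    using ex_borel_integrable_version[OF integrable_norm[OF Bu[unfolded set_integrable_def]]] by auto
  have [measurable]: "b \<in> borel_measurable borel" "c \<in> borel_measurable borel"
    using b(1) c(1) by auto
  \<comment> \<open>All exceptional times are collected in one Borel null set \<open>N\<close>. It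
    includes 0, since the initial value is not assumed to lie in \<open>D\<close>.\<close>
  have "AE s in lborel. (0 < s \<longrightarrow> u s \<in> D) \<and> norm (indicator {0..T} s *\<^sub>R B (u s)) = c s \<and> s \<noteq> 0"
    using uD[unfolded AE_completion_iff] c(2) AE_lborel_singleton[of 0] by eventually_elim auto
  from AE_lborel_null_set[OF this] obtain N where N: "N \<in> null_sets lborel"
    "\<forall>s. s \<notin> N \<longrightarrow> (0 < s \<longrightarrow> u s \<in> D) \<and> norm (indicator {0..T} s *\<^sub>R B (u s)) = c s \<and> s \<noteq> 0"
    by blast
  have good: "u s \<in> D" "norm (B (u s)) = c s" if "0 \<le> s" "s \<le> T" "s \<notin> N" for s
  proof -
    have "(0 < s \<longrightarrow> u s \<in> D) \<and> norm (indicator {0..T} s *\<^sub>R B (u s)) = c s \<and> s \<noteq> 0"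
      using N(2) that(3) by blast
    then show "u s \<in> D" "norm (B (u s)) = c s" using that(1,2) by auto
  qed
  have [measurable]: "N \<in> sets borel" using N(1) by auto
  have "bounded (u ` {0..T})"
    using cont by (intro compact_imp_bounded compact_continuous_image) (auto intro: continuous_on_subset)
  then obtain M where "\<forall>t\<in>{0..T}. norm (u t) \<le> M"
    unfolding bounded_iff by auto
  then have M: "norm (u t) \<le> M" if "0 \<le> t" "t \<le> T" for t
    using that by simp
  have "0 \<le> M" using order_trans[OF norm_ge_zero M[of 0]] T by simp
  obtain z :: "nat \<Rightarrow> 'h"
    where z: "\<And>x y. x \<in> D \<Longrightarrow> y \<in> D \<Longrightarrow> (\<lambda>k. inner x (z k) * inner y (z k)) sums inner (B x) y"
    using positive_symmetric_form_sums[OF positive_symmetric_axioms] by blast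
  \<comment> \<open>The positivity condition tests with functions continuous on the whole line;
    \<open>max 0 t\<close> extends \<open>u\<close> by its initial value.\<close>
  define \<psi> where "\<psi> k t = inner (u (max 0 t)) (z k)" for k t
  have \<psi>_cont: "continuous_on UNIV (\<psi> k)" for k
    unfolding \<psi>_def by (intro continuous_intros continuous_on_compose2[OF cont]) auto
  then have [measurable]: "\<psi> k \<in> borel_measurable borel" for k
    by (rule borel_measurable_continuous_onI)
  define S where "S k = (\<lambda>(t, s). indicator triangle (t, s) * (b (t - s) * (\<psi> k s * \<psi> k t)))" for k
  have S: "integrable (lborel \<Otimes>\<^sub>M lborel) (S k)" "0 \<le> integral\<^sup>L (lborel \<Otimes>\<^sub>M lborel) (S k)" for k
    using positive_type_double_integral[OF b \<psi>_cont, of k] by (simp_all add: S_def)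
  have [measurable]: "S k \<in> borel_measurable (borel \<Otimes>\<^sub>M borel)" for k
    unfolding S_def by measurable
  \<comment> \<open>Cutting out \<open>N\<close> in both variables makes the series expansion
    converge at every point of the plane.\<close>
  define I :: "real \<times> real \<Rightarrow> real" where "I = (\<lambda>(t, s). indicator (- N) t * indicator (- N) s)"
  have [measurable]: "I \<in> borel_measurable (borel \<Otimes>\<^sub>M borel)" unfolding I_def by measurable
  define X where "X n z = I z * (\<Sum>k<n. S k z)" for n z
  have X_meas [measurable]: "X n \<in> borel_measurable (lborel \<Otimes>\<^sub>M lborel)" for n unfolding X_def by measurable
  define K where "K = (\<lambda>(t, s). I (t, s) * (indicator triangle (t, s) * (b (t - s) * inner (B (u s)) (u t))))"
  have limX: "(\<lambda>n. X n (t, s)) \<longlonglongrightarrow> K (t, s)" for t s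
  proof (cases "(t, s) \<in> triangle \<and> t \<notin> N \<and> s \<notin> N")
    case True
    then have "u s \<in> D" "u t \<in> D" using good by auto
    then have "(\<lambda>k. inner (u s) (z k) * inner (u t) (z k)) sums inner (B (u s)) (u t)"
      by (rule z)
    then have "(\<lambda>n. b (t - s) * (\<Sum>k<n. inner (u s) (z k) * inner (u t) (z k))) \<longlonglongrightarrow> b (t - s) * inner (B (u s)) (u t)"
      unfolding sums_def by (rule tendsto_mult_left)
    then show ?thesis
      using True by (simp add: X_def K_def S_def I_def \<psi>_def sum_distrib_left max_def)
  qed (auto simp: X_def K_def S_def I_def indicator_def)
  \<comment> \<open>Joint measurability comes from the pointwise limit of the functions
    \<open>X n\<close>; \<open>B (u s)\<close> itself is known to be Lebesgue measurable
    only.\<close>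
  have K_meas: "K \<in> borel_measurable (lborel \<Otimes>\<^sub>M lborel)"
    by (rule borel_measurable_LIMSEQ_real[OF _ X_meas]) (use limX in \<open>auto simp: split_paired_all\<close>)
  \<comment> \<open>The inequality \<open>2 * \<bar>x * y\<bar> \<le> x\<^sup>2 + y\<^sup>2\<close>
    separates the partial sums into diagonal ones, which \<open>form_le\<close> bounds uniformly in
    \<open>n\<close> at each of the two times.\<close>
  define W where "W = (\<lambda>z. M / 2 * ((case z of (t, s) \<Rightarrow> \<bar>b (t - s)\<bar> * \<bar>c s\<bar>) + (case z of (t, s) \<Rightarrow> \<bar>b (t - s)\<bar> * \<bar>c t\<bar>)))"
  have W: "integrable (lborel \<Otimes>\<^sub>M lborel) W"
    unfolding W_def
    using integrable_convolution_pair[of "\<lambda>x. \<bar>b x\<bar>" "\<lambda>x. \<bar>c x\<bar>"]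
      integrable_shifted_mult[of "\<lambda>x. \<bar>b x\<bar>" "\<lambda>x. \<bar>c x\<bar>"] b(1) c(1)
    by (intro integrable_mult_right Bochner_Integration.integrable_add) auto
  have form_le: "(\<Sum>k<n. (inner (u s) (z k))\<^sup>2) \<le> M * \<bar>c s\<bar>" if "0 \<le> s" "s \<le> T" "s \<notin> N" for s n
  proof -
    have *: "(\<lambda>k. (inner (u s) (z k))\<^sup>2) sums inner (B (u s)) (u s)"
      using z[OF good(1)[OF that] good(1)[OF that]] by (simp add: power2_eq_square)
    have "(\<Sum>k<n. (inner (u s) (z k))\<^sup>2) \<le> inner (B (u s)) (u s)"
      using sum_le_suminf[OF sums_summable[OF *], of "{..<n}"] sums_unique[OF *] by simp
    also have "\<dots> \<le> norm (B (u s)) * norm (u s)" by (rule norm_cauchy_schwarz)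
    also have "\<dots> \<le> \<bar>c s\<bar> * M"
      using good(2)[OF that] M[OF that(1,2)] by (intro mult_mono) auto
    finally show ?thesis by (simp add: mult.commute)
  qed
  have bound: "\<bar>X n (t, s)\<bar> \<le> W (t, s)" for n t s
  proof (cases "(t, s) \<in> triangle \<and> t \<notin> N \<and> s \<notin> N")
    case True
    have "2 * \<bar>\<Sum>k<n. inner (u s) (z k) * inner (u t) (z k)\<bar> \<le> (\<Sum>k<n. 2 * \<bar>inner (u s) (z k) * inner (u t) (z k)\<bar>)"
      unfolding sum_distrib_left[symmetric] by (intro mult_left_mono sum_abs) simp
    also have "\<dots> \<le> (\<Sum>k<n. (inner (u s) (z k))\<^sup>2 + (inner (u t) (z k))\<^sup>2)"
    proof (rule sum_mono)
      fix k
      show "2 * \<bar>inner (u s) (z k) * inner (u t) (z k)\<bar> \<le> (inner (u s) (z k))\<^sup>2 + (inner (u t) (z k))\<^sup>2"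
        using sum_squares_bound[of "\<bar>inner (u s) (z k)\<bar>" "\<bar>inner (u t) (z k)\<bar>"] by (simp add: abs_mult)
    qed
    also have "\<dots> \<le> M * \<bar>c s\<bar> + M * \<bar>c t\<bar>"
      unfolding sum.distrib using True by (intro add_mono form_le) auto
    finally have "\<bar>\<Sum>k<n. inner (u s) (z k) * inner (u t) (z k)\<bar> \<le> M / 2 * (\<bar>c s\<bar> + \<bar>c t\<bar>)"
      by (simp add: algebra_simps)
    from mult_left_mono[OF this, of "\<bar>b (t - s)\<bar>"]
    show ?thesis
      using True by (simp add: X_def S_def I_def \<psi>_def W_def abs_mult algebra_simps flip: sum_distrib_left)
  next
    case False
    then have "X n (t, s) = 0" by (auto simp: X_def S_def I_def indicator_def)
    then show ?thesis using \<open>0 \<le> M\<close> by (simp add: W_def)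
  qed
  have dom: "AE z in lborel \<Otimes>\<^sub>M lborel. (\<lambda>n. X n z) \<longlonglongrightarrow> K z"
    "AE z in lborel \<Otimes>\<^sub>M lborel. norm (X n z) \<le> W z" for n
    using limX bound by (auto intro!: AE_I2 simp: split_paired_all)
  note K_lim = integral_dominated_convergence[OF K_meas X_meas W dom]
  note K_int = integrable_dominated_convergence[OF K_meas X_meas W dom]
  have "N \<times> UNIV \<union> UNIV \<times> N \<in> null_sets (lborel \<Otimes>\<^sub>M lborel)"
    using N(1) by (intro null_sets.Un lborel_pair.times_in_null_sets1 lborel_pair.times_in_null_sets2) auto
  then have I1: "AE z in lborel \<Otimes>\<^sub>M lborel. I z = 1"
    by (rule AE_mp[OF AE_not_in]) (auto simp: I_def indicator_def)
  have X_nonneg: "0 \<le> integral\<^sup>L (lborel \<Otimes>\<^sub>M lborel) (X n)" for n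
  proof -
    have "integral\<^sup>L (lborel \<Otimes>\<^sub>M lborel) (X n) = integral\<^sup>L (lborel \<Otimes>\<^sub>M lborel) (\<lambda>z. \<Sum>k<n. S k z)"
      by (rule integral_cong_AE) (use I1 in \<open>auto simp: X_def\<close>)
    also have "\<dots> = (\<Sum>k<n. integral\<^sup>L (lborel \<Otimes>\<^sub>M lborel) (S k))"
      using S(1) by (intro Bochner_Integration.integral_sum)
    finally show ?thesis using S(2) by (simp add: sum_nonneg)
  qed
  have K_nonneg: "0 \<le> integral\<^sup>L (lborel \<Otimes>\<^sub>M lborel) K"
    using X_nonneg by (intro LIMSEQ_le_const[OF K_lim]) auto
  \<comment> \<open>For almost every \<open>t\<close> the function \<open>b (t - s) * c s\<close> is
    integrable in \<open>s\<close>; for these \<open>t\<close> the convolution converges absolutely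
    and may be paired with \<open>u t\<close> under the integral.\<close>
  have ae: "AE t in lborel. indicator {0..T} t *\<^sub>R inner (conv t) (u t) = (LINT s|lborel. K (t, s))"
    using lborel_pair.AE_integrable_fst'[OF integrable_convolution_pair[OF b(1) c(1)]] AE_not_in[OF N(1)]
  proof eventually_elim
    case (elim t)
    show ?case
    proof (cases "t \<in> {0..T}")
      case True
      define F where "F s = indicator {0..t} s *\<^sub>R (\<beta> (t - s) *\<^sub>R B (u s))" for s
      have ae_s: "AE s in lborel. s \<noteq> t \<and> s \<notin> N \<and> indicator {0<..T} (t - s) * \<beta> (t - s) = b (t - s)"
        using AE_lborel_reflect[OF b(2), of t] AE_not_in[OF N(1)] AE_lborel_singleton[of t] by eventually_elim auto
      have F: "integrable lebesgue F"
      proof (rule Bochner_Integration.integrable_bound)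
        show "integrable lebesgue (\<lambda>s. b (t - s) * c s)"
          using elim(1) by (subst integrable_completion) auto
        have "(\<lambda>s. indicator {0<..T} (t - s) * \<beta> (t - s)) \<in> borel_measurable lebesgue"
          by (rule measurable_completion_AE_eq[where g = "\<lambda>s. b (t - s)"]) (use ae_s in auto)
        moreover have "(\<lambda>s. indicator {0..T} s *\<^sub>R B (u s)) \<in> borel_measurable lebesgue"
          using Bu by (auto simp: set_integrable_def)
        ultimately have *: "(\<lambda>s. (indicator {0<..T} (t - s) * \<beta> (t - s)) *\<^sub>R (indicator {0..T} s *\<^sub>R B (u s))) \<in> borel_measurable lebesgue"
          by (rule borel_measurable_scaleR)
        have "(\<lambda>s. (indicator {..<t} s :: real) *\<^sub>R F s) = (\<lambda>s. (indicator {0<..T} (t - s) * \<beta> (t - s)) *\<^sub>R (indicator {0..T} s *\<^sub>R B (u s)))"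
          using True by (auto simp: F_def indicator_def fun_eq_iff)
        with * have *: "(\<lambda>s. (indicator {..<t} s :: real) *\<^sub>R F s) \<in> borel_measurable lebesgue" by simp
        \<comment> \<open>The half-open \<open>{0<..T}\<close> yields measurability for
          \<open>s < t\<close>; the endpoint \<open>s = t\<close> is added as a single
          point.\<close>
        have "F = (\<lambda>s. (indicator {..<t} s :: real) *\<^sub>R F s + indicator {t} s *\<^sub>R F t)"
          by (auto simp: F_def indicator_def fun_eq_iff)
        moreover have "(\<lambda>s. (indicator {t} s :: real) *\<^sub>R F t) \<in> borel_measurable lebesgue"
          by (intro borel_measurable_scaleR borel_measurable_indicator) auto
        ultimately show "F \<in> borel_measurable lebesgue"
          using borel_measurable_add[OF *] by metis
        show "AE s in lebesgue. norm (F s) \<le> norm (b (t - s) * c s)"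
          using AE_completion[OF ae_s]
        proof eventually_elim
          case (elim s)
          then show ?case
            using True good(2)[of s] by (auto simp: F_def indicator_def abs_mult intro!: mult_left_mono split: if_splits)
        qed
      qed
      have "inner (conv t) (u t) = (LINT s|lebesgue. inner (F s) (u t))"
        using F by (simp add: set_lebesgue_integral_def F_def[abs_def] del: inner_scaleR_left)
      also have "\<dots> = (LINT s|lborel. K (t, s))"
      proof (rule integral_completion_AE_eq)
        show "(\<lambda>s. K (t, s)) \<in> borel_measurable lborel"
          using K_meas by measurable
        show "AE s in lborel. inner (F s) (u t) = K (t, s)"
          using ae_s
        proof eventually_elim
          case (elim s)
          then show ?case
            using True \<open>t \<notin> N\<close> by (auto simp: F_def K_def I_def indicator_def split: if_splits)
        qed
      qed
      finally show ?thesis using True by simp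
    next
      case False
      then have "K (t, s) = 0" for s by (auto simp: K_def indicator_def)
      then show ?thesis using False by simp
    qed
  qed
  have meas: "(\<lambda>t. LINT s|lborel. K (t, s)) \<in> borel_measurable lborel"
    using lborel_pair.integrable_fst'[OF K_int] by auto
  show ?int
    using integrable_completion_AE_eq[OF meas ae] lborel_pair.integrable_fst'[OF K_int]
    by (simp add: set_integrable_def)
  show ?nonneg
    using integral_completion_AE_eq[OF meas ae] lborel_pair.integral_fst'[OF K_int] K_nonneg
    by (simp add: set_lebesgue_integral_def)
qed

end

section \<open>The energy inequality\<close>

text \<open>Symmetry is the inclusion of the graph of \<open>B\<close> in the graph of its
  adjoint.\<close>

lemma positive_symmetric_if_self_adjoint:
  assumes "self_adjoint_in H D B" "positive_operator_on D B"
  shows "positive_symmetric D B"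
proof
  have lin: "linear_operator_in H D B" and adj: "adjoint_graph H D B = operator_graph D B"
    using assms(1) by (simp_all add: self_adjoint_in_def)
  show "subspace D" using lin by (simp add: linear_operator_in_def)
  fix x y c assume x: "x \<in> D"
  show "B (c *\<^sub>R x) = c *\<^sub>R B x" using lin x by (simp add: linear_operator_in_def)
  show "0 \<le> inner (B x) x" using assms(2) x by (simp add: positive_operator_on_def)
  assume y: "y \<in> D"
  show "B (x + y) = B x + B y" using lin x y by (simp add: linear_operator_in_def)
  have "(y, B y) \<in> adjoint_graph H D B" using y by (auto simp: adj operator_graph_def)
  then show "inner (B x) y = inner x (B y)" using x by (simp add: adjoint_graph_def)
qed

lemma admissible_kernel_set_integrable:
  assumes "admissible_kernel \<beta>"
  shows "set_integrable lebesgue {0<..T} \<beta>"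
proof -
  have "set_integrable lebesgue {1/2..max 1 T} \<beta>" "set_integrable lebesgue {0<..<1} \<beta>"
    using assms by (auto simp: admissible_kernel_def)
  then have "set_integrable lebesgue ({1/2..max 1 T} \<union> {0<..<1}) \<beta>"
    by (intro set_integrable_Un) auto
  then show ?thesis
    by (rule set_integrable_subset) auto
qed

lemma volterra_solution_continuous:
  assumes "volterra_solution H D B \<beta> f u0 u"
  shows "continuous_on {0..} u"
proof -
  obtain u' where u': "\<And>T. 0 < T \<Longrightarrow> set_integrable lebesgue {0..T} u'"
    "\<And>t. 0 \<le> t \<Longrightarrow> u t = u 0 + (LINT s:{0..t}|lebesgue. u' s)"
    using assms unfolding volterra_solution_def by blast
  have "continuous_on {0..} (\<lambda>t. u 0 + (LINT s:{0..t}|lebesgue. u' s))"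
    by (intro continuous_intros continuous_on_indefinite_set_integral u'(1))
  then show ?thesis
    by (rule continuous_on_eq) (simp add: u'(2)[symmetric])
qed

text \<open>\<open>h\<close> plays the role of \<open>inner (f t) (u t)\<close>. It is built from
  the left-hand side of the equation, where integrability is available term by term; the two memory
  terms have nonnegative integrals and are dropped.\<close>

theorem volterra_energy:
  fixes D :: "nat \<Rightarrow> 'h::{real_inner,banach,second_countable_topology} set"
  assumes B: "\<And>q. q \<in> {1,2} \<Longrightarrow> positive_symmetric (D q) (B q)"
    and \<beta>: "\<And>q. q \<in> {1,2} \<Longrightarrow> admissible_kernel (\<beta> q)"
    and sol: "volterra_solution H D B \<beta> f u0 u"
  obtains h where "\<And>T. 0 < T \<Longrightarrow> set_integrable lebesgue {0..T} h"
    and "\<And>T. 0 < T \<Longrightarrow> (norm (u T))\<^sup>2 \<le> (norm u0)\<^sup>2 + 2 * (LINT t:{0..T}|lebesgue. h t)"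
    and "AE t in lebesgue. 0 < t \<longrightarrow> h t = inner (f t) (u t)"
proof -
  obtain u' where u': "\<And>T. 0 < T \<Longrightarrow> set_integrable lebesgue {0..T} u'"
    "\<And>t. 0 \<le> t \<Longrightarrow> u t = u 0 + (LINT s:{0..t}|lebesgue. u' s)"
    "AE t in lebesgue. 0 < t \<longrightarrow> (u has_vector_derivative u' t) (at t) \<and>
        u' t + (\<Sum>q\<in>{1,2}. LINT s:{0..t}|lebesgue. \<beta> q (t - s) *\<^sub>R B q (u s)) = f t"
    using sol unfolding volterra_solution_def by blast
  have u0: "u 0 = u0" using sol by (simp add: volterra_solution_def)
  define P where "P t = (LINT s:{0..t}|lebesgue. u' s)" for t
  define C where "C q t = (LINT s:{0..t}|lebesgue. \<beta> q (t - s) *\<^sub>R B q (u s))" for q t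
  define k where "k q t = inner (C q t) (u t)" for q t
  define h where "h t = inner (u' t) (u t) + (k 1 t + k 2 t)" for t
  have k: "set_integrable lebesgue {0..T} (k q)" "0 \<le> (LINT t:{0..T}|lebesgue. k q t)"
    if "0 < T" "q \<in> {1,2}" for T q
  proof -
    have uq: "AE t in lebesgue. 0 < t \<longrightarrow> u t \<in> D q" "set_integrable lebesgue {0..T} (\<lambda>s. B q (u s))"
      using sol that unfolding volterra_solution_def by blast+
    interpret volterra_positive "D q" "B q" "\<beta> q" u T
    proof (intro volterra_positive.intro volterra_positive_axioms.intro)
      show "positive_type_kernel (\<beta> q)" using \<beta>[OF that(2)] by (simp add: admissible_kernel_def)
    qed (use uq that B[OF that(2)] admissible_kernel_set_integrable[OF \<beta>[OF that(2)]]
        volterra_solution_continuous[OF sol] in simp_all)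
    show "set_integrable lebesgue {0..T} (k q)" "0 \<le> (LINT t:{0..T}|lebesgue. k q t)"
      using convolution_inner_nonneg by (simp_all add: k_def[abs_def] C_def)
  qed
  have energy: "set_integrable lebesgue {0..T} (\<lambda>t. inner (u' t) (u t))"
    "(norm (u T))\<^sup>2 = (norm u0)\<^sup>2 + 2 * (LINT t:{0..T}|lebesgue. inner (u' t) (u t))" if "0 < T" for T
  proof -
    note parts = set_integral_by_parts_inner[OF u'(1)[OF that] u'(1)[OF that], folded P_def]
    \<comment> \<open>Integration by parts with both functions equal to \<open>u'\<close> replaces
      the chain rule for the squared norm.\<close>
    have PP: "2 * (LINT t:{0..T}|lebesgue. inner (u' t) (P t)) = (norm (P T))\<^sup>2"
      using parts(3) by (simp add: inner_commute[of "P _" "u' _"] power2_norm_eq_inner)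
    have c: "set_integrable lebesgue {0..T} (\<lambda>t. inner (u' t) u0)"
      using integrable_inner_left[of u0 lebesgue "\<lambda>t. indicator {0..T} t *\<^sub>R u' t"] u'(1)[OF that]
      by (simp add: set_integrable_def)
    have c': "(LINT t:{0..T}|lebesgue. inner (u' t) u0) = inner (P T) u0"
      using integral_inner_left[of u0 lebesgue "\<lambda>t. indicator {0..T} t *\<^sub>R u' t"] u'(1)[OF that]
      by (simp add: set_integrable_def set_lebesgue_integral_def P_def)
    have eq: "inner (u' t) (u t) = inner (u' t) u0 + inner (u' t) (P t)" if "t \<in> {0..T}" for t
      using u'(2)[of t] that by (simp add: u0 P_def inner_add_right)
    have "set_integrable lebesgue {0..T} (\<lambda>t. inner (u' t) u0 + inner (u' t) (P t))"
      using c parts(2) by (rule set_integral_add)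
    then show "set_integrable lebesgue {0..T} (\<lambda>t. inner (u' t) (u t))"
      by (rule set_integrable_cong[THEN iffD1, rotated 3]) (use eq in auto)
    have "(LINT t:{0..T}|lebesgue. inner (u' t) (u t)) = (LINT t:{0..T}|lebesgue. inner (u' t) u0 + inner (u' t) (P t))"
      by (rule set_lebesgue_integral_cong) (use eq in auto)
    also have "\<dots> = inner (P T) u0 + (LINT t:{0..T}|lebesgue. inner (u' t) (P t))"
      using c parts(2) by (simp add: set_integral_add c')
    finally have "2 * (LINT t:{0..T}|lebesgue. inner (u' t) (u t)) = 2 * inner (P T) u0 + (norm (P T))\<^sup>2"
      using PP by simp
    moreover have "u T = u0 + P T" using u'(2)[of T] that by (simp add: u0 P_def)
    ultimately show "(norm (u T))\<^sup>2 = (norm u0)\<^sup>2 + 2 * (LINT t:{0..T}|lebesgue. inner (u' t) (u t))"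
      by (simp add: power2_norm_eq_inner inner_add_left inner_add_right inner_commute)
  qed
  show thesis
  proof
    fix T :: real assume T: "0 < T"
    have k12: "set_integrable lebesgue {0..T} (\<lambda>t. k 1 t + k 2 t)"
      using k(1)[OF T] by (intro set_integral_add) auto
    show "set_integrable lebesgue {0..T} h"
      unfolding h_def using energy(1)[OF T] k12 by (rule set_integral_add)
    have "(LINT t:{0..T}|lebesgue. h t) = (LINT t:{0..T}|lebesgue. inner (u' t) (u t)) +
        ((LINT t:{0..T}|lebesgue. k 1 t) + (LINT t:{0..T}|lebesgue. k 2 t))"
      unfolding h_def using set_integral_add(2)[OF energy(1)[OF T] k12] set_integral_add(2)[of lebesgue "{0..T}" "k 1" "k 2"] k(1)[OF T]
      by simp
    then show "(norm (u T))\<^sup>2 \<le> (norm u0)\<^sup>2 + 2 * (LINT t:{0..T}|lebesgue. h t)"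
      using energy(2)[OF T] k(2)[OF T, of 1] k(2)[OF T, of 2] by simp
  next
    show "AE t in lebesgue. 0 < t \<longrightarrow> h t = inner (f t) (u t)"
      using u'(3)
    proof eventually_elim
      case (elim t)
      show ?case
      proof
        assume "0 < t"
        then have "f t = u' t + (C 1 t + C 2 t)" using elim by (simp add: C_def)
        then show "h t = inner (f t) (u t)"
          by (simp add: h_def k_def inner_add_left)
      qed
    qed
  qed
qed

section \<open>The exponential weight and the half-line\<close>

lemma set_integral_exp_neg:
  fixes c t :: real
  assumes "0 < c" "0 \<le> t"
  shows "(LINT s:{0..t}|lebesgue. exp (- (c * s))) = (1 - exp (- (c * t))) / c"
proof -
  have "((\<lambda>s. exp (- (c * s))) has_integral (- exp (- (c * t)) / c) - (- exp (- (c * 0)) / c)) {0..t}"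
    using assms
    by (intro fundamental_theorem_of_calculus[where f = "\<lambda>s. - exp (- (c * s)) / c"])
      (auto intro!: derivative_eq_intros simp flip: has_real_derivative_iff_has_vector_derivative)
  then have "integral {0..t} (\<lambda>s. exp (- (c * s))) = (1 - exp (- (c * t))) / c"
    by (simp add: integral_unique diff_divide_distrib)
  moreover have "set_integrable lebesgue {0..t} (\<lambda>s. exp (- (c * s)))"
    by (intro absolutely_integrable_continuous_real continuous_intros)
  ultimately show ?thesis
    by (simp add: set_lebesgue_integral_eq_integral(2))
qed

lemma set_integrable_mult_continuous:
  fixes h g :: "real \<Rightarrow> real"
  assumes h: "set_integrable lebesgue {a..b} h" and g: "continuous_on {a..b} g"
  shows "set_integrable lebesgue {a..b} (\<lambda>t. g t * h t)"
proof -
  have "(\<lambda>t. g t * h t) absolutely_integrable_on {a..b}"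
  proof (rule absolutely_integrable_bounded_measurable_product_real)
    show "g \<in> borel_measurable (lebesgue_on {a..b})"
      using g by (intro continuous_imp_measurable_on_sets_lebesgue) auto
    show "bounded (g ` {a..b})"
      using g by (intro compact_imp_bounded compact_continuous_image) auto
  qed (use h in auto)
  then show ?thesis .
qed

text \<open>Integrate the hypothesis against \<open>exp (- (c * t))\<close> and integrate by parts,
  which moves the inner integral from \<open>h\<close> to the weight.\<close>

lemma weighted_energy_bound:
  fixes v h :: "real \<Rightarrow> real"
  assumes c: "0 < c" and T: "0 < T" and a: "0 \<le> a"
    and h: "set_integrable lebesgue {0..T} h"
    and v: "continuous_on {0..T} v"
    and le: "\<And>t. 0 \<le> t \<Longrightarrow> t \<le> T \<Longrightarrow> v t \<le> a + 2 * (LINT s:{0..t}|lebesgue. h s)"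
  shows "(LINT t:{0..T}|lebesgue. exp (- (c * t)) * v t)
      \<le> a / c + (LINT t:{0..T}|lebesgue. (exp (- (c * t)) - exp (- (c * T))) * (2 * h t / c))"
proof -
  define H where "H t = (LINT s:{0..t}|lebesgue. h s)" for t
  define e where "e t = exp (- (c * t))" for t :: real
  define Q where "Q t = (LINT s:{0..t}|lebesgue. e s)" for t
  have e_cont: "continuous_on A e" for A unfolding e_def by (intro continuous_intros)
  have e: "set_integrable lebesgue {0..T} e"
    by (intro absolutely_integrable_continuous_real e_cont)
  have Q: "Q t = (1 - e t) / c" if "0 \<le> t" for t
    using set_integral_exp_neg[OF c that] by (simp add: Q_def e_def)
  note parts = set_integral_by_parts_inner[OF h e, folded H_def Q_def, unfolded inner_real_def]
  have He: "(LINT t:{0..T}|lebesgue. H t * e t) = (LINT t:{0..T}|lebesgue. (e t - e T) * (h t / c))"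
  proof -
    have "H T * Q T = (LINT t:{0..T}|lebesgue. h t * Q T)"
      by (simp add: H_def)
    then have "(LINT t:{0..T}|lebesgue. H t * e t) = (LINT t:{0..T}|lebesgue. h t * Q T) - (LINT t:{0..T}|lebesgue. h t * Q t)"
      using parts(3) by linarith
    also have "\<dots> = (LINT t:{0..T}|lebesgue. h t * Q T - h t * Q t)"
      using h parts(2) by (intro set_integral_diff(2)[symmetric] set_integrable_mult_left) auto
    \<comment> \<open>\<open>Q T - Q t\<close> is the tail \<open>(e t - e T) / c\<close> of the
      exponential integral.\<close>
    also have "\<dots> = (LINT t:{0..T}|lebesgue. (e t - e T) * (h t / c))"
    proof (rule set_lebesgue_integral_cong)
      show "\<forall>t. t \<in> {0..T} \<longrightarrow> h t * Q T - h t * Q t = (e t - e T) * (h t / c)"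
        using T c by (auto simp: Q field_simps)
    qed simp
    finally show ?thesis .
  qed
  have "(LINT t:{0..T}|lebesgue. e t * v t) \<le> (LINT t:{0..T}|lebesgue. a * e t + 2 * (H t * e t))"
  proof (rule set_integral_mono)
    show "set_integrable lebesgue {0..T} (\<lambda>t. e t * v t)"
      by (intro absolutely_integrable_continuous_real continuous_intros e_cont v)
    show "set_integrable lebesgue {0..T} (\<lambda>t. a * e t + 2 * (H t * e t))"
      using e parts(1) by (intro set_integral_add set_integrable_mult_right) auto
    fix t assume "t \<in> {0..T}"
    then have "e t * v t \<le> e t * (a + 2 * H t)"
      using le[of t] by (intro mult_left_mono) (auto simp: H_def e_def)
    then show "e t * v t \<le> a * e t + 2 * (H t * e t)" by (simp add: algebra_simps)
  qed
  also have "\<dots> = a * Q T + 2 * (LINT t:{0..T}|lebesgue. H t * e t)"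
    using e parts(1) by (simp add: set_integral_add Q_def)
  also have "\<dots> \<le> a / c + 2 * (LINT t:{0..T}|lebesgue. H t * e t)"
  proof -
    have "Q T \<le> 1 / c" using T c by (simp add: Q e_def divide_right_mono)
    then show ?thesis using mult_left_mono[OF _ a] by fastforce
  qed
  also have "2 * (LINT t:{0..T}|lebesgue. H t * e t) = (LINT t:{0..T}|lebesgue. 2 * ((e t - e T) * (h t / c)))"
    by (simp add: He)
  also have "\<dots> = (LINT t:{0..T}|lebesgue. (e t - e T) * (2 * h t / c))"
    by (rule arg_cong[where f = "set_lebesgue_integral lebesgue {0..T}"]) (auto simp: fun_eq_iff)
  finally show ?thesis by (simp add: e_def)
qed

text \<open>\<open>ennreal\<close> sends negative values to 0, so the right-hand side is the
  integral of the positive part.\<close>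

lemma ennreal_integral_le_nn_integral:
  fixes f :: "'a \<Rightarrow> real"
  assumes "integrable M f"
  shows "ennreal (integral\<^sup>L M f) \<le> (\<integral>\<^sup>+x. ennreal (f x) \<partial>M)"
proof -
  have "ennreal (integral\<^sup>L M f) \<le> ennreal (integral\<^sup>L M (\<lambda>x. max 0 (f x)))"
    using assms by (intro ennreal_leI integral_mono) auto
  also have "\<dots> = (\<integral>\<^sup>+x. ennreal (max 0 (f x)) \<partial>M)"
    using assms by (intro nn_integral_eq_integral[symmetric]) auto
  also have "\<dots> = (\<integral>\<^sup>+x. ennreal (f x) \<partial>M)"
    by (intro nn_integral_cong) (simp add: max_def ennreal_neg)
  finally show ?thesis .
qed

lemma L2H_norm_square:
  "(L2H_norm s0 w)\<^sup>2 = (\<integral>\<^sup>+t\<in>{0..}. ennreal ((norm (w t))\<^sup>2 * exp (- 2 * s0 * t)) \<partial>lebesgue)"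
  by (auto simp: L2H_norm_def Let_def ennreal_power less_top)

text \<open>Monotone convergence along the horizons \<open>n + 1\<close>, all of which are
  positive.\<close>

lemma nn_integral_atLeast_leI:
  fixes g :: "real \<Rightarrow> real"
  assumes g: "continuous_on {0..} g" and nonneg: "\<And>t. 0 \<le> t \<Longrightarrow> 0 \<le> g t"
    and le: "\<And>T. 0 < T \<Longrightarrow> ennreal (LINT t:{0..T}|lebesgue. g t) \<le> C"
  shows "(\<integral>\<^sup>+t\<in>{0..}. ennreal (g t) \<partial>lebesgue) \<le> C"
proof -
  define T where "T n = real n + 1" for n :: nat
  have T: "0 < T n" for n by (simp add: T_def)
  have int: "set_integrable lebesgue {0..T n} g" for n
    by (intro absolutely_integrable_continuous_real continuous_on_subset[OF g]) auto
  have "(\<integral>\<^sup>+t\<in>{0..}. ennreal (g t) \<partial>lebesgue) = (\<integral>\<^sup>+t. (SUP n. ennreal (indicator {0..T n} t * g t)) \<partial>lebesgue)"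
  proof (rule nn_integral_cong)
    fix t :: real
    show "ennreal (g t) * indicator {0..} t = (SUP n. ennreal (indicator {0..T n} t * g t))"
    proof (cases "0 \<le> t")
      case True
      obtain n :: nat where "t \<le> real n" using real_arch_simple by blast
      then have "t \<in> {0..T n}" using True by (simp add: T_def)
      have "(SUP n. ennreal (indicator {0..T n} t * g t)) = ennreal (g t)"
      proof (rule antisym)
        show "(SUP n. ennreal (indicator {0..T n} t * g t)) \<le> ennreal (g t)"
          using nonneg[OF True] by (intro SUP_least) (auto simp: indicator_def)
        show "ennreal (g t) \<le> (SUP n. ennreal (indicator {0..T n} t * g t))"
          using \<open>t \<in> {0..T n}\<close> by (intro SUP_upper2[of n]) auto
      qed
      then show ?thesis using True by simp
    qed simp
  qed
  also have "\<dots> = (SUP n. \<integral>\<^sup>+t. ennreal (indicator {0..T n} t * g t) \<partial>lebesgue)"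
  proof (rule nn_integral_monotone_convergence_SUP)
    show "incseq (\<lambda>n t. ennreal (indicator {0..T n} t * g t))"
      using nonneg by (auto simp: incseq_def le_fun_def T_def indicator_def intro!: ennreal_leI)
    show "(\<lambda>t. ennreal (indicator {0..T n} t * g t)) \<in> borel_measurable lebesgue" for n
      using int[of n] by (auto simp: set_integrable_def)
  qed
  also have "\<dots> = (SUP n. ennreal (LINT t:{0..T n}|lebesgue. g t))"
    using int nonneg by (intro SUP_cong refl, subst nn_integral_eq_integral)
      (auto simp: set_integrable_def set_lebesgue_integral_def indicator_def)
  also have "\<dots> \<le> C"
    by (intro SUP_least le T)
  finally show ?thesis .
qed

theorem theorem2p5:
  fixes \<Omega> :: "'a::euclidean_space set"
    and \<beta> :: "nat \<Rightarrow> real \<Rightarrow> real"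
    and D :: "nat \<Rightarrow> 'a L2 set" and B :: "nat \<Rightarrow> 'a L2 \<Rightarrow> 'a L2"
    and f u :: "real \<Rightarrow> 'a L2" and u\<^sub>0 :: "'a L2" and s\<^sub>0 :: real
  assumes "\<Omega> \<in> sets lebesgue"
    and "\<And>q. q \<in> {1,2} \<Longrightarrow> admissible_kernel (\<beta> q)"
    and "\<And>q. q \<in> {1,2} \<Longrightarrow> self_adjoint_in (L2_on \<Omega>) (D q) (B q)"
    and "\<And>q. q \<in> {1,2} \<Longrightarrow> positive_operator_on (D q) (B q)"
    and "\<And>t. 0 \<le> t \<Longrightarrow> f t \<in> L2_on \<Omega>"
    and "u\<^sub>0 \<in> L2_on \<Omega>"
    and "volterra_solution (L2_on \<Omega>) D B \<beta> f u\<^sub>0 u"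
    and "0 < s\<^sub>0"
  shows "(L2H_norm s\<^sub>0 u)\<^sup>2 \<le>
    ennreal (inverse s\<^sub>0 * (norm u\<^sub>0)\<^sup>2) + ennreal ((inverse s\<^sub>0)\<^sup>2) * (L2H_norm s\<^sub>0 f)\<^sup>2"
proof -
  note sol = \<open>volterra_solution (L2_on \<Omega>) D B \<beta> f u\<^sub>0 u\<close> and s0 = \<open>0 < s\<^sub>0\<close>
  have ps: "positive_symmetric (D q) (B q)" if "q \<in> {1,2}" for q
    using assms(3,4)[OF that] by (rule positive_symmetric_if_self_adjoint)
  obtain h where h: "\<And>T. 0 < T \<Longrightarrow> set_integrable lebesgue {0..T} h"
    "\<And>T. 0 < T \<Longrightarrow> (norm (u T))\<^sup>2 \<le> (norm u\<^sub>0)\<^sup>2 + 2 * (LINT t:{0..T}|lebesgue. h t)"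
    "AE t in lebesgue. 0 < t \<longrightarrow> h t = inner (f t) (u t)"
    using volterra_energy[OF ps assms(2) sol] by blast
  have u_cont: "continuous_on {0..} u" using sol by (rule volterra_solution_continuous)
  have u0: "u 0 = u\<^sub>0" using sol by (simp add: volterra_solution_def)
  define v where "v t = (norm (u t))\<^sup>2" for t
  define e where "e t = exp (- (2 * s\<^sub>0 * t))" for t
  define F where "F = (\<integral>\<^sup>+t\<in>{0..}. ennreal ((norm (f t))\<^sup>2 * exp (- 2 * s\<^sub>0 * t)) \<partial>lebesgue)"
  have v_cont: "continuous_on {0..} v" unfolding v_def by (intro continuous_intros u_cont)
  have e_cont: "continuous_on A e" for A unfolding e_def by (intro continuous_intros)
  have "ennreal (LINT t:{0..T}|lebesgue. v t * exp (- 2 * s\<^sub>0 * t))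
      \<le> ennreal (inverse s\<^sub>0 * (norm u\<^sub>0)\<^sup>2) + ennreal ((inverse s\<^sub>0)\<^sup>2) * F" if T: "0 < T" for T
  proof -
    define w where "w t = e t - e T" for t
    \<comment> \<open>By Young's inequality \<open>Z t\<close> is at most
      \<open>(norm (f t))\<^sup>2 * e t\<close> for almost every \<open>t\<close>. Comparing the
      integrals in \<open>ennreal\<close> also covers data with infinite \<open>F\<close>.\<close>
    define Z where "Z t = w t * (2 * s\<^sub>0 * h t) - w t * (s\<^sub>0\<^sup>2 * v t)" for t
    define J where "J = (LINT t:{0..T}|lebesgue. w t * (2 * s\<^sub>0 * h t))"
    define Y where "Y = (LINT t:{0..T}|lebesgue. e t * v t)"
    have vT: "continuous_on {0..T} v" using v_cont by (rule continuous_on_subset) auto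
    have w: "0 \<le> w t" "w t \<le> e t" if "t \<in> {0..T}" for t
      using that s0 by (auto simp: w_def e_def)
    have w_cont: "continuous_on {0..T} w" unfolding w_def by (intro continuous_intros e_cont)
    have int1: "set_integrable lebesgue {0..T} (\<lambda>t. w t * (2 * s\<^sub>0 * h t))"
      using h(1)[OF T] by (intro set_integrable_mult_continuous set_integrable_mult_right w_cont) auto
    have int2: "set_integrable lebesgue {0..T} (\<lambda>t. w t * (s\<^sub>0\<^sup>2 * v t))"
      by (intro absolutely_integrable_continuous_real continuous_intros w_cont vT)
    have Z: "set_integrable lebesgue {0..T} Z"
      unfolding Z_def using int1 int2 by (rule set_integral_diff)
    have AE_nonzero: "AE t in lebesgue. t \<noteq> (0::real)"
      by (rule AE_I'[of "{0}"]) auto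
    have "ennreal (LINT t:{0..T}|lebesgue. Z t) \<le> (\<integral>\<^sup>+t. ennreal (indicator {0..T} t *\<^sub>R Z t) \<partial>lebesgue)"
      using Z unfolding set_lebesgue_integral_def set_integrable_def by (rule ennreal_integral_le_nn_integral)
    also have "\<dots> \<le> F"
      unfolding F_def
    proof (rule nn_integral_mono_AE)
      show "AE t in lebesgue. ennreal (indicator {0..T} t *\<^sub>R Z t)
          \<le> ennreal ((norm (f t))\<^sup>2 * exp (- 2 * s\<^sub>0 * t)) * indicator {0..} t"
        using h(3) AE_nonzero
      proof eventually_elim
        case (elim t)
        show ?case
        proof (cases "t \<in> {0..T}")
          case True
          then have "h t = inner (f t) (u t)" using elim by auto
          also have "\<dots> \<le> norm (f t) * norm (u t)" by (rule norm_cauchy_schwarz)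
          finally have "2 * s\<^sub>0 * h t \<le> 2 * norm (f t) * (s\<^sub>0 * norm (u t))"
            using s0 by simp
          also have "\<dots> \<le> (norm (f t))\<^sup>2 + s\<^sub>0\<^sup>2 * v t"
            using sum_squares_bound[of "norm (f t)" "s\<^sub>0 * norm (u t)"] by (simp add: v_def power_mult_distrib)
          finally have "w t * (2 * s\<^sub>0 * h t - s\<^sub>0\<^sup>2 * v t) \<le> w t * (norm (f t))\<^sup>2"
            using w(1)[OF True] by (intro mult_left_mono) auto
          also have "\<dots> \<le> e t * (norm (f t))\<^sup>2"
            using w(2)[OF True] by (rule mult_right_mono) simp
          finally show ?thesis
            using True by (auto simp: Z_def e_def algebra_simps intro!: ennreal_leI)
        qed simp
      qed
    qed
    finally have ZF: "ennreal (LINT t:{0..T}|lebesgue. Z t) \<le> F" .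
    have "Y \<le> (norm u\<^sub>0)\<^sup>2 / (2 * s\<^sub>0) + (LINT t:{0..T}|lebesgue. w t * (2 * h t / (2 * s\<^sub>0)))"
      unfolding Y_def e_def w_def
    proof (rule weighted_energy_bound[OF _ T _ h(1)[OF T] vT])
      fix t :: real assume "0 \<le> t"
      show "v t \<le> (norm u\<^sub>0)\<^sup>2 + 2 * (LINT s:{0..t}|lebesgue. h s)"
      \<comment> \<open>The energy inequality is available for positive times; at 0 the integral
        over one point vanishes.\<close>
      proof (cases "t = 0")
        case True
        have "(LINT s:{0..0}|lebesgue. h s) = 0"
          unfolding set_lebesgue_integral_def
        proof (rule integral_eq_zero_AE)
          show "AE s in lebesgue. indicator {0..0} s *\<^sub>R h s = 0"
            using AE_nonzero by eventually_elim simp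
        qed
        with True show ?thesis by (simp add: v_def u0)
      next
        case False
        with \<open>0 \<le> t\<close> show ?thesis using h(2)[of t] by (simp add: v_def)
      qed
    qed (use s0 in auto)
    also have "(LINT t:{0..T}|lebesgue. w t * (2 * h t / (2 * s\<^sub>0)))
        = (LINT t:{0..T}|lebesgue. (1 / (2 * s\<^sub>0\<^sup>2)) * (w t * (2 * s\<^sub>0 * h t)))"
      using s0 by (intro arg_cong[where f = "set_lebesgue_integral lebesgue {0..T}"]) (auto simp: fun_eq_iff power2_eq_square)
    also have "\<dots> = (1 / (2 * s\<^sub>0\<^sup>2)) * J"
      unfolding J_def by (rule set_integral_mult_right)
    \<comment> \<open>The factor clears the denominators and leaves two copies of
      \<open>s\<^sub>0\<^sup>2 * Y\<close> on the left; \<open>Y2\<close> below bounds the quadratic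
      term of \<open>Z\<close> by one of them.\<close>
    finally have "2 * s\<^sub>0\<^sup>2 * Y \<le> 2 * s\<^sub>0\<^sup>2 * ((norm u\<^sub>0)\<^sup>2 / (2 * s\<^sub>0) + (1 / (2 * s\<^sub>0\<^sup>2)) * J)"
      by (intro mult_left_mono) auto
    also have "\<dots> = s\<^sub>0 * (norm u\<^sub>0)\<^sup>2 + J"
      using s0 by (simp add: field_simps power2_eq_square)
    finally have Y1: "2 * s\<^sub>0\<^sup>2 * Y \<le> s\<^sub>0 * (norm u\<^sub>0)\<^sup>2 + J" .
    have "(LINT t:{0..T}|lebesgue. w t * (s\<^sub>0\<^sup>2 * v t)) \<le> (LINT t:{0..T}|lebesgue. s\<^sub>0\<^sup>2 * (e t * v t))"
    proof (rule set_integral_mono[OF int2])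
      show "set_integrable lebesgue {0..T} (\<lambda>t. s\<^sub>0\<^sup>2 * (e t * v t))"
        by (intro absolutely_integrable_continuous_real continuous_intros e_cont vT)
      show "w t * (s\<^sub>0\<^sup>2 * v t) \<le> s\<^sub>0\<^sup>2 * (e t * v t)" if "t \<in> {0..T}" for t
        using mult_right_mono[OF w(2)[OF that], of "s\<^sub>0\<^sup>2 * v t"] by (simp add: v_def algebra_simps)
    qed
    then have Y2: "(LINT t:{0..T}|lebesgue. w t * (s\<^sub>0\<^sup>2 * v t)) \<le> s\<^sub>0\<^sup>2 * Y"
      by (simp add: Y_def)
    have "(LINT t:{0..T}|lebesgue. Z t)
        = J - (LINT t:{0..T}|lebesgue. w t * (s\<^sub>0\<^sup>2 * v t))"
      unfolding Z_def J_def using int1 int2 by (rule set_integral_diff)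
    with Y1 Y2 have "s\<^sub>0\<^sup>2 * Y \<le> s\<^sub>0 * (norm u\<^sub>0)\<^sup>2 + (LINT t:{0..T}|lebesgue. Z t)"
      by linarith
    from mult_left_mono[OF this, of "(inverse s\<^sub>0)\<^sup>2"]
    have "Y \<le> inverse s\<^sub>0 * (norm u\<^sub>0)\<^sup>2 + (inverse s\<^sub>0)\<^sup>2 * (LINT t:{0..T}|lebesgue. Z t)"
      using s0 by (simp add: field_simps power2_eq_square)
    \<comment> \<open>The integral of \<open>Z\<close> may be negative, and \<open>ennreal\<close>
      is additive on nonnegative reals.\<close>
    also have "\<dots> \<le> inverse s\<^sub>0 * (norm u\<^sub>0)\<^sup>2 + (inverse s\<^sub>0)\<^sup>2 * max 0 (LINT t:{0..T}|lebesgue. Z t)"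
      by (intro add_left_mono mult_left_mono) auto
    finally have "ennreal Y \<le> ennreal (inverse s\<^sub>0 * (norm u\<^sub>0)\<^sup>2 + (inverse s\<^sub>0)\<^sup>2 * max 0 (LINT t:{0..T}|lebesgue. Z t))"
      by (rule ennreal_leI)
    also have "\<dots> = ennreal (inverse s\<^sub>0 * (norm u\<^sub>0)\<^sup>2) + ennreal ((inverse s\<^sub>0)\<^sup>2) * ennreal (LINT t:{0..T}|lebesgue. Z t)"
      using s0 by (simp add: ennreal_plus ennreal_mult' max_def ennreal_neg)
    also have "\<dots> \<le> ennreal (inverse s\<^sub>0 * (norm u\<^sub>0)\<^sup>2) + ennreal ((inverse s\<^sub>0)\<^sup>2) * F"
      by (intro add_left_mono mult_left_mono ZF) simp
    finally show ?thesis
      by (simp add: Y_def e_def mult.commute)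
  qed
  then have "(\<integral>\<^sup>+t\<in>{0..}. ennreal (v t * exp (- 2 * s\<^sub>0 * t)) \<partial>lebesgue)
      \<le> ennreal (inverse s\<^sub>0 * (norm u\<^sub>0)\<^sup>2) + ennreal ((inverse s\<^sub>0)\<^sup>2) * F"
    by (intro nn_integral_atLeast_leI continuous_intros v_cont) (auto simp: v_def)
  then show ?thesis
    by (simp add: L2H_norm_square v_def F_def)
qed

end
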